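(* A datum $(\mathbf{c},\mathbf{d},\mathbf{B})$ is gaussian-extremizable if and only if it is equivalent to a geometric datum $(\mathbf{c},\mathbf{d},\mathbf{B}')$.
   Context: Let $E_1,\dots,E_k$ and $E^1,\dots,E^m$ be Euclidean spaces (finite-dimensional real Hilbert spaces), $E_0=\bigoplus_{i=1}^kE_i$ (orthogonal direct sum, each $E_i\subseteq E_0$), and $\pi_{E_i}:E_0\to E_i$ the orthogonal projection. Let $\mathbf{c}=(c_i)_{1\le i\le k}$, $\mathbf{d}=(d_j)_{1\le j\le m}$ be positive real numbers with $\sum_ic_i\dim(E_i)=\sum_jd_j\dim(E^j)$. Let $\mathbf{B}=(B_{ij})$ with $B_{ij}:E_i\to E^j$ linear; equivalently $\mathbf{B}$ is given by the maps $B_j:E_0\to E^j$, $B_jx=\sum_{i}B_{ij}\pi_{E_i}(x)$. The triple $(\mathbf{c},\mathbf{d},\mathbf{B})$ is a datum. $S(E)$ denotes the self-adjoint operators on $E$, $S^+(E)$ the positive-definite ones; $A\ge B$ means $A-B$ is positive-semidefinite. $\Lambda_{\mathbf c}=\bigoplus_ic_i\,\mathrm{id}_{E_i}$ and, for $V_i\in S^+(E_i)$, $V_{\mathbf c}=\bigoplus_ic_iV_i$. $\Pi(\mathrm{id}_{E_1},\dots,\mathrm{id}_{E_k})$ is the set of positive-semidefinite $A\in S(E_0)$ with $\langle Ax_i,x_i\rangle=\langle x_i,x_i\rangle$ for all $x_i\in E_i$, $1\le i\le k$. Gaussian-extremizable: the supremum $\frac12\sup\big(\sum_jd_j\log\det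 U_j-\sum_ic_i\log\det V_i\big)$ over all $V_i\in S^+(E_i)$, $U_j\in S^+(E^j)$ satisfying $\sum_jd_j\Lambda_{\mathbf c}B_j^*U_jB_j\Lambda_{\mathbf c}\le V_{\mathbf c}$ is finite and attained. Geometric: the datum satisfies $\sum_ic_i\dim(E_i)=\sum_jd_j\dim(E^j)$ and the maps $Q_j:=B_j\Lambda_{\mathbf c}$ satisfy $\sum_jd_jQ_j^*Q_j\le\Lambda_{\mathbf c}$ and $Q_j\Sigma Q_j^*=\mathrm{id}_{E^j}$, $1\le j\le m$, for some $\Sigma\in\Pi(\mathrm{id}_{E_1},\dots,\mathrm{id}_{E_k})$. Equivalent: $(\mathbf{c},\mathbf{d},\mathbf{B})$ and $(\mathbf{c}',\mathbf{d}',\mathbf{B}')$ are equivalent if $\mathbf{c}=\mathbf{c}'$, $\mathbf{d}=\mathbf{d}'$, and there exist invertible linear transformations $C:E_0\to E_0$ and $C_j:E^j\to E^j$ such that $B_j'=C_j^{-1}B_jC^{-1}$ for each $1\le j\le m$.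
   Formalization: In the definition of equivalent data, the invertible map C on E_0 is required to map each E_i into itself (a direct sum of invertible maps E_i → E_i); for C mixing summands the claim fails, e.g. c=(1,1), d=2, all spaces R, B=(1,0), B'=(1/2,1/2). *)

theory Defs
  imports "HOL-Analysis.Analysis" "Jordan_Normal_Form.Determinant"
begin

text \<open>
  Euclidean spaces are linear subspaces of ambient types of class \<open>euclidean_space\<close>: \<open>E i\<close> in
  \<open>'a\<close> and \<open>F j\<close> (the spaces with upper index) in \<open>'b\<close>. So the dimensions are arbitrary (zero
  included) and may vary with the index. A linear map between two such subspaces is represented by
  a linear map of the ambient types; only its values on the source subspace are ever used.
  The name \<open>inner\<close> is spelled out because its infix symbol is shared with the scalar
  product of the matrix library.
\<close>

definition selfadjoint_on :: "'a::euclidean_space set \<Rightarrow> ('a \<Rightarrow> 'a) \<Rightarrow> bool" where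
  "selfadjoint_on S f \<longleftrightarrow>
     linear f \<and> f ` S \<subseteq> S \<and> (\<forall>x\<in>S. \<forall>y\<in>S. inner (f x) y = inner x (f y))"

definition possemidef_on :: "'a::euclidean_space set \<Rightarrow> ('a \<Rightarrow> 'a) \<Rightarrow> bool" where
  "possemidef_on S f \<longleftrightarrow> selfadjoint_on S f \<and> (\<forall>x\<in>S. 0 \<le> inner (f x) x)"

definition posdef_on :: "'a::euclidean_space set \<Rightarrow> ('a \<Rightarrow> 'a) \<Rightarrow> bool" where
  "posdef_on S f \<longleftrightarrow> selfadjoint_on S f \<and> (\<forall>x\<in>S. x \<noteq> 0 \<longrightarrow> 0 < inner (f x) x)"

definition op_le_on :: "'a::euclidean_space set \<Rightarrow> ('a \<Rightarrow> 'a) \<Rightarrow> ('a \<Rightarrow> 'a) \<Rightarrow> bool" where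
  "op_le_on S f g \<longleftrightarrow> possemidef_on S (\<lambda>x. g x - f x)"

definition orth_proj :: "'a::euclidean_space set \<Rightarrow> 'a \<Rightarrow> 'a" where
  "orth_proj S x = (THE y. y \<in> S \<and> (\<forall>z\<in>S. inner (x - y) z = 0))"

definition orthonormal_basis :: "'a::euclidean_space set \<Rightarrow> 'a list \<Rightarrow> bool" where
  "orthonormal_basis S bs \<longleftrightarrow> span (set bs) = S \<and>
     (\<forall>i<length bs. \<forall>j<length bs. inner (bs ! i) (bs ! j) = (if i = j then 1 else 0))"

definition matrix_wrt :: "'a::euclidean_space list \<Rightarrow> ('a \<Rightarrow> 'a) \<Rightarrow> real mat" where
  "matrix_wrt bs f =
     Matrix.mat (length bs) (length bs) (\<lambda>(i, j). inner (bs ! i) (f (bs ! j)))"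

text \<open>
  The determinant of an operator on \<open>S\<close> does not depend on the chosen orthonormal basis, see
  \<open>det_on_eq\<close> below. It is \<open>1\<close> on the zero space.
\<close>

definition det_on :: "'a::euclidean_space set \<Rightarrow> ('a \<Rightarrow> 'a) \<Rightarrow> real" where
  "det_on S f = Determinant.det (matrix_wrt (SOME bs. orthonormal_basis S bs) f)"

definition direct_sum :: "('k \<Rightarrow> 'a::euclidean_space set) \<Rightarrow> 'a set" where
  "direct_sum E = span (\<Union>i. E i)"

definition is_datum ::
  "('k::finite \<Rightarrow> 'a::euclidean_space set) \<Rightarrow> ('m::finite \<Rightarrow> 'b::euclidean_space set)
    \<Rightarrow> ('k \<Rightarrow> real) \<Rightarrow> ('m \<Rightarrow> real) \<Rightarrow> ('k \<Rightarrow> 'm \<Rightarrow> 'a \<Rightarrow> 'b) \<Rightarrow> bool" where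
  "is_datum E F c d B \<longleftrightarrow>
     (\<forall>i. subspace (E i)) \<and> (\<forall>j. subspace (F j)) \<and>
     (\<forall>i i'. i \<noteq> i' \<longrightarrow> (\<forall>x\<in>E i. \<forall>y\<in>E i'. inner x y = 0)) \<and>
     (\<forall>i. 0 < c i) \<and> (\<forall>j. 0 < d j) \<and>
     (\<forall>i j. linear (B i j) \<and> B i j ` E i \<subseteq> F j) \<and>
     (\<Sum>i\<in>UNIV. c i * real (dim (E i))) = (\<Sum>j\<in>UNIV. d j * real (dim (F j)))"

definition total_map ::
  "('k::finite \<Rightarrow> 'a::euclidean_space set) \<Rightarrow> ('k \<Rightarrow> 'm \<Rightarrow> 'a \<Rightarrow> 'b::euclidean_space)
    \<Rightarrow> 'm \<Rightarrow> 'a \<Rightarrow> 'b" where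
  "total_map E B j x = (\<Sum>i\<in>UNIV. B i j (orth_proj (E i) x))"

definition weighted_sum ::
  "('k::finite \<Rightarrow> 'a::euclidean_space set) \<Rightarrow> ('k \<Rightarrow> real) \<Rightarrow> ('k \<Rightarrow> 'a \<Rightarrow> 'a) \<Rightarrow> 'a \<Rightarrow> 'a" where
  "weighted_sum E c V x = (\<Sum>i\<in>UNIV. c i *\<^sub>R V i (orth_proj (E i) x))"

definition Lambda ::
  "('k::finite \<Rightarrow> 'a::euclidean_space set) \<Rightarrow> ('k \<Rightarrow> real) \<Rightarrow> 'a \<Rightarrow> 'a" where
  "Lambda E c = weighted_sum E c (\<lambda>i x. x)"

text \<open>
  \<open>total_map E B j\<close> vanishes on the orthogonal complement of \<open>direct_sum E\<close> and has its values in
  \<open>F j\<close>. Hence the ambient \<open>adjoint\<close>, restricted to \<open>F j\<close>, is the adjoint of the map from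
  \<open>direct_sum E\<close> to \<open>F j\<close>; the same holds for \<open>Q_map E c B j\<close>.
\<close>

definition Q_map ::
  "('k::finite \<Rightarrow> 'a::euclidean_space set) \<Rightarrow> ('k \<Rightarrow> real)
    \<Rightarrow> ('k \<Rightarrow> 'm \<Rightarrow> 'a \<Rightarrow> 'b::euclidean_space) \<Rightarrow> 'm \<Rightarrow> 'a \<Rightarrow> 'b" where
  "Q_map E c B j x = total_map E B j (Lambda E c x)"

definition gauss_feasible ::
  "('k::finite \<Rightarrow> 'a::euclidean_space set) \<Rightarrow> ('m::finite \<Rightarrow> 'b::euclidean_space set)
    \<Rightarrow> ('k \<Rightarrow> real) \<Rightarrow> ('m \<Rightarrow> real) \<Rightarrow> ('k \<Rightarrow> 'm \<Rightarrow> 'a \<Rightarrow> 'b)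
    \<Rightarrow> ('k \<Rightarrow> 'a \<Rightarrow> 'a) \<Rightarrow> ('m \<Rightarrow> 'b \<Rightarrow> 'b) \<Rightarrow> bool" where
  "gauss_feasible E F c d B V U \<longleftrightarrow>
     (\<forall>i. posdef_on (E i) (V i)) \<and> (\<forall>j. posdef_on (F j) (U j)) \<and>
     op_le_on (direct_sum E)
       (\<lambda>x. \<Sum>j\<in>UNIV. d j *\<^sub>R
          Lambda E c (adjoint (total_map E B j) (U j (total_map E B j (Lambda E c x)))))
       (weighted_sum E c V)"

definition gauss_values ::
  "('k::finite \<Rightarrow> 'a::euclidean_space set) \<Rightarrow> ('m::finite \<Rightarrow> 'b::euclidean_space set)
    \<Rightarrow> ('k \<Rightarrow> real) \<Rightarrow> ('m \<Rightarrow> real) \<Rightarrow> ('k \<Rightarrow> 'm \<Rightarrow> 'a \<Rightarrow> 'b) \<Rightarrow> real set" where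
  "gauss_values E F c d B =
     {1/2 * ((\<Sum>j\<in>UNIV. d j * ln (det_on (F j) (U j))) - (\<Sum>i\<in>UNIV. c i * ln (det_on (E i) (V i))))
      | V U. gauss_feasible E F c d B V U}"

definition gaussian_extremizable ::
  "('k::finite \<Rightarrow> 'a::euclidean_space set) \<Rightarrow> ('m::finite \<Rightarrow> 'b::euclidean_space set)
    \<Rightarrow> ('k \<Rightarrow> real) \<Rightarrow> ('m \<Rightarrow> real) \<Rightarrow> ('k \<Rightarrow> 'm \<Rightarrow> 'a \<Rightarrow> 'b) \<Rightarrow> bool" where
  "gaussian_extremizable E F c d B \<longleftrightarrow>
     bdd_above (gauss_values E F c d B) \<and> Sup (gauss_values E F c d B) \<in> gauss_values E F c d B"

definition id_couplings :: "('k \<Rightarrow> 'a::euclidean_space set) \<Rightarrow> ('a \<Rightarrow> 'a) set" where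
  "id_couplings E =
     {A. possemidef_on (direct_sum E) A \<and> (\<forall>i. \<forall>x\<in>E i. inner (A x) x = inner x x)}"

definition geometric ::
  "('k::finite \<Rightarrow> 'a::euclidean_space set) \<Rightarrow> ('m::finite \<Rightarrow> 'b::euclidean_space set)
    \<Rightarrow> ('k \<Rightarrow> real) \<Rightarrow> ('m \<Rightarrow> real) \<Rightarrow> ('k \<Rightarrow> 'm \<Rightarrow> 'a \<Rightarrow> 'b) \<Rightarrow> bool" where
  "geometric E F c d B \<longleftrightarrow>
     (\<Sum>i\<in>UNIV. c i * real (dim (E i))) = (\<Sum>j\<in>UNIV. d j * real (dim (F j))) \<and>
     op_le_on (direct_sum E)
       (\<lambda>x. \<Sum>j\<in>UNIV. d j *\<^sub>R adjoint (Q_map E c B j) (Q_map E c B j x))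
       (Lambda E c) \<and>
     (\<exists>\<Sigma>\<in>id_couplings E. \<forall>j. \<forall>y\<in>F j. Q_map E c B j (\<Sigma> (adjoint (Q_map E c B j) y)) = y)"

definition invertible_on :: "'a::euclidean_space set \<Rightarrow> ('a \<Rightarrow> 'a) \<Rightarrow> bool" where
  "invertible_on S f \<longleftrightarrow> linear f \<and> bij_betw f S S"

text \<open>
  The transformation \<open>C\<close> of the direct sum has to respect the decomposition, i.e. be
  a direct sum of invertible maps \<open>E i \<rightarrow> E i\<close>. For a \<open>C\<close> that mixes the summands, gaussian
  extremizability is not an invariant: take \<open>c = (1, 1)\<close>, \<open>d = 2\<close> and all spaces equal to the real
  line. Then \<open>B = (1/2, 1/2)\<close> is geometric, while \<open>B = (1, 0)\<close>, which is \<open>(1/2, 1/2)\<close> composed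
  with an invertible map of the plane, has infinite supremum.
\<close>

definition equivalent_data ::
  "('k::finite \<Rightarrow> 'a::euclidean_space set) \<Rightarrow> ('m::finite \<Rightarrow> 'b::euclidean_space set)
    \<Rightarrow> ('k \<Rightarrow> real) \<Rightarrow> ('m \<Rightarrow> real) \<Rightarrow> ('k \<Rightarrow> 'm \<Rightarrow> 'a \<Rightarrow> 'b)
    \<Rightarrow> ('k \<Rightarrow> real) \<Rightarrow> ('m \<Rightarrow> real) \<Rightarrow> ('k \<Rightarrow> 'm \<Rightarrow> 'a \<Rightarrow> 'b) \<Rightarrow> bool" where
  "equivalent_data E F c d B c' d' B' \<longleftrightarrow> c = c' \<and> d = d' \<and>
     (\<exists>C D. invertible_on (direct_sum E) C \<and> (\<forall>i. C ` E i \<subseteq> E i) \<and>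
        (\<forall>j. invertible_on (F j) (D j)) \<and>
        (\<forall>j. \<forall>x\<in>direct_sum E.
           total_map E B' j x =
           inv_into (F j) (D j) (total_map E B j (inv_into (direct_sum E) C x))))"

lemma orthonormal_basis_props:
  fixes S :: "'a::euclidean_space set"
  assumes "orthonormal_basis S bs"
  shows "distinct bs" and "length bs = dim S" and "\<And>i. i < length bs \<Longrightarrow> bs ! i \<in> S"
    and "\<And>x. x \<in> S \<Longrightarrow> x = (\<Sum>i<length bs. inner (bs ! i) x *\<^sub>R bs ! i)"
proof -
  have on: "inner (bs ! i) (bs ! j) = (if i = j then 1 else 0)"
    if "i < length bs" "j < length bs" for i j
    using assms that unfolding orthonormal_basis_def by blast
  have sp: "span (set bs) = S" using assms unfolding orthonormal_basis_def by blast
  show d: "distinct bs" unfolding distinct_conv_nth by (metis on zero_neq_one)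
  have po: "pairwise Linear_Algebra.orthogonal (set bs)"
    unfolding pairwise_def Linear_Algebra.orthogonal_def by (metis in_set_conv_nth on)
  have nm: "norm b = 1" if "b \<in> set bs" for b
    using that by (metis in_set_conv_nth on norm_eq_1)
  then have nz: "0 \<notin> set bs" by (metis norm_zero zero_neq_one)
  have ind: "independent (set bs)" using pairwise_orthogonal_independent[OF po nz] .
  show "length bs = dim S"
    using d ind sp by (metis dim_span dim_eq_card_independent distinct_card)
  show "bs ! i \<in> S" if "i < length bs" for i
    using that sp by (metis nth_mem span_base)
  show "x = (\<Sum>i<length bs. inner (bs ! i) x *\<^sub>R bs ! i)" if "x \<in> S" for x
  proof -
    have "x \<in> span (set bs)" using that sp by simp
    then have "(\<Sum>b\<in>set bs. inner x b *\<^sub>R b) = x"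
      using orthonormal_basis_expand[OF po nm] by simp
    moreover have "(\<Sum>b\<in>set bs. inner x b *\<^sub>R b) = (\<Sum>i<length bs. inner (bs ! i) x *\<^sub>R bs ! i)"
      using sum.reindex_bij_betw[OF bij_betw_nth[OF d refl refl], of "\<lambda>b. inner x b *\<^sub>R b"]
      by (simp add: inner_commute)
    ultimately show ?thesis by simp
  qed
qed

lemma orthonormal_basis_exists:
  assumes "subspace S"
  shows "\<exists>bs. orthonormal_basis S bs"
proof -
  obtain B where B: "B \<subseteq> S" "pairwise Linear_Algebra.orthogonal B" "\<And>x. x \<in> B \<Longrightarrow> norm x = 1"
    "independent B" "card B = dim S" "span B = S"
    using orthonormal_basis_subspace[OF assms] by metis
  obtain bs where bs: "set bs = B" "distinct bs"
    using independent_imp_finite[OF B(4)] finite_distinct_list by metis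
  have "inner (bs ! i) (bs ! j) = (if i = j then 1 else 0)"
    if "i < length bs" "j < length bs" for i j
    using that bs B(2) B(3) unfolding pairwise_def Linear_Algebra.orthogonal_def
    by (metis norm_eq_1 nth_eq_iff_index_eq nth_mem)
  then show ?thesis using B(6) bs(1) unfolding orthonormal_basis_def by blast
qed

lemma det_matrix_wrt_indep:
  assumes bs: "orthonormal_basis S bs" and cs: "orthonormal_basis S cs"
    and f: "linear f" "f ` S \<subseteq> S"
  shows "Determinant.det (matrix_wrt bs f) = Determinant.det (matrix_wrt cs f)"
proof -
  define n where "n = length bs"
  note b = orthonormal_basis_props[OF bs] and c = orthonormal_basis_props[OF cs]
  have nc: "length cs = n" using b(2) c(2) n_def by simp
  define P where "P = Matrix.mat n n (\<lambda>(i, j). inner (bs ! i) (cs ! j))"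
  define R where "R = Matrix.mat n n (\<lambda>(i, j). inner (cs ! i) (bs ! j))"
  let ?B = "matrix_wrt bs f" and ?C = "matrix_wrt cs f"
  have car: "P \<in> carrier_mat n n" "R \<in> carrier_mat n n"
    "?B \<in> carrier_mat n n" "?C \<in> carrier_mat n n"
    by (auto simp: P_def R_def matrix_wrt_def n_def nc[unfolded n_def])
  have exb: "inner x y = (\<Sum>k<n. inner x (bs ! k) * inner (bs ! k) y)" if "y \<in> S" for x y
    by (subst b(4)[OF that]) (simp add: inner_sum_right n_def mult.commute)
  have exc: "inner x y = (\<Sum>k<n. inner x (cs ! k) * inner (cs ! k) y)" if "y \<in> S" for x y
    by (subst c(4)[OF that]) (simp add: inner_sum_right nc mult.commute)
  have fS: "f x \<in> S" if "x \<in> S" for x using f(2) that by blast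
  have PR: "P * R = 1\<^sub>m n"
  proof (rule eq_matI)
    fix i j assume "i < dim_row (1\<^sub>m n :: real mat)" "j < dim_col (1\<^sub>m n :: real mat)"
    then have ij: "i < n" "j < n" by auto
    have "(P * R) $$ (i, j) = (\<Sum>k<n. inner (bs ! i) (cs ! k) * inner (cs ! k) (bs ! j))"
      using ij by (simp add: P_def R_def scalar_prod_def lessThan_atLeast0)
    also have "\<dots> = inner (bs ! i) (bs ! j)"
      using exc b(3) ij n_def by simp
    also have "\<dots> = (1\<^sub>m n) $$ (i, j)"
      using bs ij unfolding orthonormal_basis_def n_def by simp
    finally show "(P * R) $$ (i, j) = (1\<^sub>m n) $$ (i, j)" .
  qed (auto simp: P_def R_def)
  have "?B * P = P * ?C"
  proof (rule eq_matI)
    fix i j assume "i < dim_row (P * ?C)" "j < dim_col (P * ?C)"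
    then have ij: "i < n" "j < n" by (auto simp: P_def matrix_wrt_def nc)
    have cj: "cs ! j \<in> S" using c(3) ij nc by simp
    have "(?B * P) $$ (i, j) = (\<Sum>k<n. inner (bs ! i) (f (bs ! k)) * inner (bs ! k) (cs ! j))"
      using ij by (simp add: P_def matrix_wrt_def scalar_prod_def lessThan_atLeast0 n_def)
    also have "\<dots> = inner (bs ! i) (f (\<Sum>k<n. inner (bs ! k) (cs ! j) *\<^sub>R bs ! k))"
      by (simp add: linear_sum[OF f(1)] linear_scale[OF f(1)] inner_sum_right mult.commute)
    also have "\<dots> = inner (bs ! i) (f (cs ! j))"
      using b(4)[OF cj] n_def by simp
    also have "\<dots> = (\<Sum>k<n. inner (bs ! i) (cs ! k) * inner (cs ! k) (f (cs ! j)))"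
      by (rule exc) (rule fS[OF cj])
    also have "\<dots> = (P * ?C) $$ (i, j)"
      using ij by (simp add: P_def matrix_wrt_def scalar_prod_def lessThan_atLeast0 nc)
    finally show "(?B * P) $$ (i, j) = (P * ?C) $$ (i, j)" .
  qed (auto simp: P_def matrix_wrt_def nc n_def)
  then have "Determinant.det ?B * Determinant.det P = Determinant.det P * Determinant.det ?C"
    using det_mult car by metis
  moreover have "Determinant.det P \<noteq> 0"
    using det_mult[OF car(1,2)] PR by auto
  ultimately show ?thesis by simp
qed

lemma det_on_eq:
  assumes "orthonormal_basis S bs" "linear f" "f ` S \<subseteq> S"
  shows "det_on S f = Determinant.det (matrix_wrt bs f)"
  unfolding det_on_def
  using assms by (intro det_matrix_wrt_indep[where S = S]) (auto intro: someI)

lemma orth_proj_eqI: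
  assumes "subspace S" "y \<in> S" "\<And>z. z \<in> S \<Longrightarrow> inner (x - y) z = 0"
  shows "orth_proj S x = y"
  unfolding orth_proj_def
proof (rule the_equality)
  show "y \<in> S \<and> (\<forall>z\<in>S. inner (x - y) z = 0)" using assms by blast
  fix w assume w: "w \<in> S \<and> (\<forall>z\<in>S. inner (x - w) z = 0)"
  then have "w - y \<in> S" using assms by (simp add: subspace_diff)
  then have "inner (x - y) (w - y) - inner (x - w) (w - y) = 0"
    using w assms by simp
  then show "w = y" by (simp flip: inner_diff_left)
qed

end

(*
  The constraint is preserved by geometric means: if it holds for (V, U) and for the identity, then
  it also holds for (V^(1/2), U^(1/2)). Once V and U are diagonalised, this is an interpolation of
  weighted l^2 bounds. Iterating gives (V^s, U^s) with s = 2^-n; the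
  trace against the coupling of a geometric datum yields sum d tr U^s <= sum c tr V^s, with equality
  at s = 0, and the derivative at s = 0 shows that the identity is optimal.

  Conversely, a change of variables moves an optimal pair to the identity. If the set of
  positive semidefinite operators of the right trace contained no coupling as required, the residual of
  a least squares approximation would separate it from the target. Such a separating functional
  is a direction (H, G) of feasible perturbations along which the objective increases to first order.
*)

theory Submission
  imports Defs
begin

section \<open>Orthonormal bases and the spectral theorem\<close>

text \<open>For a feasible pair the trace inequality by itself only bounds the sum of d tr U, which
  says nothing about determinants. Powers are used because the derivative of tr U^s at s = 0 is log
  det U. The segment from the identity to (V, U) stays feasible as well, but along it the trace has
  the derivative tr U - tr 1, with no logarithm in it. Equality at s = 0 is the dimension condition,
  and the sequence 2^-n is enough to compute a derivative at 0.

  In the converse, every coupling has trace n = dim E0, so fixing the trace loses no candidate and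
  yields a compact convex set. It contains the multiples of the rank-one operators y -> (x, y) x of
  trace n. Testing a separating functional on these turns it into an inequality of quadratic forms
  in x, with a multiple of the squared norm of x on one side. The gap rho > 0 of the separation sits
  in that multiple and is what makes the resulting trace inequality contradictory.\<close>

lemma quadratic_nonneg_imp_zero:
  fixes a g :: real
  assumes "\<And>t. 0 \<le> 2 * t * a + t\<^sup>2 * g" "0 \<le> g"
  shows "a = 0"
proof (rule ccontr)
  assume a: "a \<noteq> 0"
  \<comment> \<open>The minimum of the parabola is at \<open>- a / g\<close>, which is meaningless
    for \<open>g = 0\<close>. With \<open>g + 1\<close> in the denominator the point is always
    defined and the value there is still negative.\<close>
  define s where "s = g + 1"
  have s: "1 \<le> s" "g = s - 1" using assms(2) by (auto simp: s_def)
  have "2 * (- a / s) * a + (- a / s)\<^sup>2 * g = - (a\<^sup>2 * (s + 1)) / s\<^sup>2"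
  proof -
    have "2 * (- a / s) * a + (- a / s)\<^sup>2 * (s - 1) = (- 2 * a\<^sup>2 * s + a\<^sup>2 * (s - 1)) / s\<^sup>2"
      using s(1) by (simp add: divide_simps power2_eq_square)
    also have "\<dots> = - (a\<^sup>2 * (s + 1)) / s\<^sup>2" by (simp add: algebra_simps)
    finally show ?thesis by (simp add: s(2))
  qed
  moreover have "\<dots> < 0"
    using a s by (auto intro!: divide_neg_pos mult_pos_pos)
  ultimately show False using assms(1)[of "- a / s"] by linarith
qed

text \<open>At a maximiser \<open>z\<close> of \<open>X x x / N x x\<close> on the unit sphere of
  \<open>S\<close>, the form \<open>l * N - X\<close> is nonnegative and vanishes, so its first
  variation at \<open>z\<close> vanishes too. A general form \<open>N\<close> is allowed because the
  result serves both the spectral theorem, with the inner product, and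
  \<open>interpolate_sqrt\<close>, with a weighted form.\<close>

lemma rayleigh_eigenvector:
  fixes X N :: "'a::euclidean_space \<Rightarrow> 'a \<Rightarrow> real"
  assumes S: "subspace S" "x0 \<in> S" "x0 \<noteq> 0"
    and X: "bilinear X" "\<And>x y. x \<in> S \<Longrightarrow> y \<in> S \<Longrightarrow> X x y = X y x"
    and N: "bilinear N" "\<And>x y. x \<in> S \<Longrightarrow> y \<in> S \<Longrightarrow> N x y = N y x"
    and Npos: "\<And>x. x \<in> S \<Longrightarrow> x \<noteq> 0 \<Longrightarrow> 0 < N x x"
  obtains z l where "z \<in> S" "z \<noteq> 0" "\<And>y. y \<in> S \<Longrightarrow> X z y = l * N z y"
    "\<And>y. y \<in> S \<Longrightarrow> X y y \<le> l * N y y"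
proof -
  have bX: "bounded_bilinear X" and bN: "bounded_bilinear N"
    using X(1) N(1) bilinear_conv_bounded_bilinear by blast+
  define K where "K = S \<inter> sphere 0 1"
  have "compact K"
    unfolding K_def using closed_subspace[OF S(1)] by (intro closed_Int_compact) auto
  moreover have "(1 / norm x0) *\<^sub>R x0 \<in> K"
    using S by (simp add: K_def subspace_scale)
  moreover have "continuous_on K (\<lambda>x. X x x / N x x)"
    using Npos by (intro continuous_on_divide bounded_bilinear.continuous_on[OF bX]
        bounded_bilinear.continuous_on[OF bN] continuous_on_id) (fastforce simp: K_def)
  ultimately obtain z where z: "z \<in> K" "\<And>y. y \<in> K \<Longrightarrow> X y y / N y y \<le> X z z / N z z"
    using continuous_attains_sup[of K "\<lambda>x. X x x / N x x"] by auto
  define l where "l = X z z / N z z"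
  have zS: "z \<in> S" "z \<noteq> 0" using z(1) by (auto simp: K_def)
  have le: "X y y \<le> l * N y y" if "y \<in> S" for y
  proof (cases "y = 0")
    case True
    then show ?thesis using X(1) N(1) by (simp add: bilinear_lzero)
  next
    case False
    define w where "w = (1 / norm y) *\<^sub>R y"
    have "w \<in> K" "w \<noteq> 0" using False that S(1) by (auto simp: K_def w_def subspace_scale)
    then have "X w w \<le> l * N w w"
      using z(2)[of w] Npos[of w] by (simp add: l_def K_def pos_divide_le_eq)
    then have "(1 / norm y)\<^sup>2 * X y y \<le> (1 / norm y)\<^sup>2 * (l * N y y)"
      using X(1) N(1)
      by (simp add: w_def bilinear_lmul bilinear_rmul power2_eq_square field_simps)
    then show ?thesis using False by (simp add: mult_le_cancel_left divide_less_0_iff)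
  qed
  have zz: "X z z = l * N z z" using Npos[OF zS] by (simp add: l_def)
  have "X z y = l * N z y" if y: "y \<in> S" for y
  proof -
    have "l * N z y - X z y = 0"
    proof (rule quadratic_nonneg_imp_zero)
      show "0 \<le> l * N y y - X y y" using le[OF y] by simp
      fix t :: real
      have "z + t *\<^sub>R y \<in> S" using S(1) zS y by (simp add: subspace_add subspace_scale)
      from le[OF this] show "0 \<le> 2 * t * (l * N z y - X z y) + t\<^sup>2 * (l * N y y - X y y)"
        using X(1) N(1) X(2)[OF y zS(1)] N(2)[OF y zS(1)] zz
        by (simp add: bilinear_ladd bilinear_radd bilinear_lmul bilinear_rmul
            power2_eq_square algebra_simps)
    qed
    then show ?thesis by simp
  qed
  with zS le show thesis using that by blast
qed

lemma orthonormal_basis_inner: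
  assumes "orthonormal_basis S bs" "i < length bs" "j < length bs"
  shows "inner (bs ! i) (bs ! j) = (if i = j then 1 else 0)"
  using assms unfolding orthonormal_basis_def by blast

lemma orthonormal_basis_imp_subspace:
  "orthonormal_basis S bs \<Longrightarrow> subspace S"
  unfolding orthonormal_basis_def by (metis subspace_span)

lemma orthonormal_basis_Parseval:
  assumes "orthonormal_basis S bs" "x \<in> S"
  shows "inner x y = (\<Sum>k<length bs. inner (bs ! k) x * inner (bs ! k) y)"
  by (subst orthonormal_basis_props(4)[OF assms]) (simp add: inner_sum_left)

lemma orthonormal_basis_inner_sum:
  assumes "orthonormal_basis S bs" "k < length bs"
  shows "inner (bs ! k) (\<Sum>i<length bs. a i *\<^sub>R bs ! i) = a k"
  using assms by (simp add: inner_sum_right orthonormal_basis_inner if_distrib cong: if_cong)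

section \<open>Orthogonal projections in coordinates\<close>

lemma orth_proj_basis:
  assumes bs: "orthonormal_basis S bs"
  shows "orth_proj S x = (\<Sum>k<length bs. inner (bs ! k) x *\<^sub>R bs ! k)"
proof (rule orth_proj_eqI)
  show sub: "subspace S" using bs by (rule orthonormal_basis_imp_subspace)
  note p = orthonormal_basis_props[OF bs]
  show y: "(\<Sum>k<length bs. inner (bs ! k) x *\<^sub>R bs ! k) \<in> S"
    using sub p(3) by (auto intro!: subspace_sum subspace_scale)
  fix z assume z: "z \<in> S"
  have "inner z (x - (\<Sum>k<length bs. inner (bs ! k) x *\<^sub>R bs ! k)) = 0"
    by (subst orthonormal_basis_Parseval[OF bs z])
      (simp add: inner_diff_right orthonormal_basis_inner_sum[OF bs])
  then show "inner (x - (\<Sum>k<length bs. inner (bs ! k) x *\<^sub>R bs ! k)) z = 0"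
    by (simp add: inner_commute)
qed

context
  fixes S :: "'a::euclidean_space set"
  assumes S: "subspace S"
begin

lemma orth_proj_linear: "linear (orth_proj S)"
proof -
  obtain bs where "orthonormal_basis S bs" using orthonormal_basis_exists[OF S] by blast
  from orth_proj_basis[OF this] have "orth_proj S = (\<lambda>x. \<Sum>k<length bs. inner (bs ! k) x *\<^sub>R bs ! k)"
    by blast
  then show ?thesis
    by (auto intro!: linearI simp: inner_add_right scaleR_add_left sum.distrib scaleR_sum_right)
qed

lemma orth_proj_in: "orth_proj S x \<in> S"
proof -
  obtain bs where "orthonormal_basis S bs" using orthonormal_basis_exists[OF S] by blast
  then show ?thesis using S orthonormal_basis_props(3)[of S bs]
    by (auto intro!: subspace_sum subspace_scale simp: orth_proj_basis)
qed

lemma orth_proj_id: "x \<in> S \<Longrightarrow> orth_proj S x = x"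
  using S by (auto intro: orth_proj_eqI)

lemma orth_proj_inner:
  assumes "y \<in> S" shows "inner (orth_proj S x) y = inner x y"
proof -
  obtain bs where bs: "orthonormal_basis S bs" using orthonormal_basis_exists[OF S] by blast
  have "inner y (orth_proj S x) = inner y x"
    unfolding orthonormal_basis_Parseval[OF bs assms]
    by (simp add: orth_proj_basis[OF bs] orthonormal_basis_inner_sum[OF bs])
  then show ?thesis by (simp add: inner_commute)
qed

lemma orth_proj_inner2:
  assumes "y \<in> S" shows "inner y (orth_proj S x) = inner y x"
  using orth_proj_inner[OF assms] by (simp add: inner_commute)

lemma orth_proj_selfadjoint: "inner (orth_proj S x) y = inner x (orth_proj S y)"
  using orth_proj_inner[OF orth_proj_in, of x y] orth_proj_inner2[OF orth_proj_in, of x y]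
  by simp

lemma orth_proj_zero: "(\<And>y. y \<in> S \<Longrightarrow> inner x y = 0) \<Longrightarrow> orth_proj S x = 0"
  using S by (auto intro!: orth_proj_eqI simp: subspace_0)

end

text \<open>Induction on the dimension: a Rayleigh eigenvector for the inner product is split off,
  and its orthogonal complement in \<open>S\<close> is invariant by selfadjointness. The ambient map
  \<open>f\<close> stays the same throughout; only the subspace shrinks.\<close>

theorem selfadjoint_diagonalizable:
  assumes "subspace S" "selfadjoint_on S f"
  obtains bs l where "orthonormal_basis S bs"
    "\<And>k. k < length bs \<Longrightarrow> f (bs ! k) = l k *\<^sub>R bs ! k"
proof -
  have "\<exists>bs l. orthonormal_basis S bs \<and> (\<forall>k<length bs. f (bs ! k) = l k *\<^sub>R bs ! k)"
    using assms
  proof (induction "dim S" arbitrary: S rule: less_induct)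
    case less
    note S = less.prems(1)
    have lin: "linear f" and fS: "\<And>x. x \<in> S \<Longrightarrow> f x \<in> S"
      and sa: "\<And>x y. x \<in> S \<Longrightarrow> y \<in> S \<Longrightarrow> inner (f x) y = inner x (f y)"
      using less.prems(2) unfolding selfadjoint_on_def by blast+
    show ?case
    proof (cases "S \<subseteq> {0}")
      case True
      then have "S = {0}" using subspace_0[OF S] by blast
      then have "orthonormal_basis S []" by (simp add: orthonormal_basis_def)
      then show ?thesis by (intro exI[of _ "[]"]) auto
    next
      case False
      then obtain x0 where x0: "x0 \<in> S" "x0 \<noteq> 0" by blast
      have bil: "bilinear (\<lambda>x y. inner (f x) y)" "bilinear (inner :: 'a \<Rightarrow> 'a \<Rightarrow> real)"
        using lin by (auto simp: bilinear_def linear_iff inner_add_left inner_add_right)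
      have sym: "inner (f x) y = inner (f y) x" if "x \<in> S" "y \<in> S" for x y
        using sa[OF that] by (simp add: inner_commute)
      obtain z l where z: "z \<in> S" "z \<noteq> 0" "\<And>y. y \<in> S \<Longrightarrow> inner (f z) y = l * inner z y"
        by (rule rayleigh_eigenvector[OF S x0 bil(1) sym bil(2)]) (auto simp: inner_commute)
      \<comment> \<open>The eigenvalue equation is only known when tested against vectors of
        \<open>S\<close>; the defect itself is such a vector.\<close>
      have "f z - l *\<^sub>R z \<in> S" using S fS z(1) by (simp add: subspace_diff subspace_scale)
      then have "inner (f z - l *\<^sub>R z) (f z - l *\<^sub>R z) = 0"
        using z(3)[of "f z - l *\<^sub>R z"] by (simp add: inner_diff_left)
      then have fz: "f z = l *\<^sub>R z" by simp
      define e where "e = (1 / norm z) *\<^sub>R z"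
      have e: "e \<in> S" "inner e e = 1" "f e = l *\<^sub>R e"
        using S z fz by (auto simp: e_def subspace_scale linear_scale[OF lin] dot_square_norm)
      define T where "T = {x \<in> S. inner e x = 0}"
      have T: "subspace T" using S by (auto simp: T_def subspace_def inner_add_right)
      have "e \<notin> T" using e by (simp add: T_def)
      then have "dim T < dim S"
        using e(1) S T by (metis (mono_tags, lifting) T_def dim_subset mem_Collect_eq nat_less_le
            subsetI subspace_dim_equal order_refl)
      moreover have "selfadjoint_on T f"
        unfolding selfadjoint_on_def
      proof (intro conjI ballI)
        show "linear f" by (fact lin)
        show "f ` T \<subseteq> T" using fS sa[OF e(1)] e(3) by (auto simp: T_def) (metis inner_scaleR_left mult_zero_right)
      qed (use sa in \<open>auto simp: T_def\<close>)
      ultimately obtain bs m where bs: "orthonormal_basis T bs"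
        and m: "\<And>k. k < length bs \<Longrightarrow> f (bs ! k) = m k *\<^sub>R bs ! k"
        using less.hyps[OF _ T] by blast
      have ort: "inner e (bs ! k) = 0" "inner (bs ! k) e = 0" if "k < length bs" for k
        using orthonormal_basis_props(3)[OF bs that] by (auto simp: T_def inner_commute)
      have "orthonormal_basis S (e # bs)"
        unfolding orthonormal_basis_def
      proof (intro conjI allI impI)
        have "set bs \<subseteq> S" using orthonormal_basis_props(3)[OF bs]
          by (auto simp: in_set_conv_nth T_def)
        then have "span (set (e # bs)) \<subseteq> S" using e(1) S by (intro span_minimal) auto
        moreover have "x \<in> span (set (e # bs))" if "x \<in> S" for x
        proof -
          have "x - inner e x *\<^sub>R e \<in> T"
            using that e S by (simp add: T_def subspace_diff subspace_scale inner_diff_right)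
          then have "x - inner e x *\<^sub>R e \<in> span (set bs)" using bs by (simp add: orthonormal_basis_def)
          then show ?thesis by (auto simp: span_insert)
        qed
        ultimately show "span (set (e # bs)) = S" by blast
        show "inner ((e # bs) ! i) ((e # bs) ! j) = (if i = j then 1 else 0)"
          if "i < length (e # bs)" "j < length (e # bs)" for i j
          using that e ort orthonormal_basis_inner[OF bs] by (auto simp: nth_Cons split: nat.splits)
      qed
      moreover have "f ((e # bs) ! k) = (case k of 0 \<Rightarrow> l | Suc k \<Rightarrow> m k) *\<^sub>R (e # bs) ! k"
        if "k < length (e # bs)" for k
        using that e(3) m by (auto split: nat.splits)
      ultimately show ?thesis by blast
    qed
  qed
  then show thesis using that by blast
qed

section \<open>Determinants and traces\<close>

text \<open>The matrix sees \<open>f\<close> only on basis vectors in \<open>S\<close>. This matters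
  because the operators built below agree with their intended values on a subspace, not on the
  ambient space.\<close>

lemma det_on_cong:
  assumes "subspace S" "\<And>x. x \<in> S \<Longrightarrow> f x = g x"
  shows "det_on S f = det_on S g"
proof -
  define bs where "bs = (SOME bs. orthonormal_basis S bs)"
  have "orthonormal_basis S bs"
    unfolding bs_def using orthonormal_basis_exists[OF assms(1)] by (rule someI_ex)
  then have "bs ! j \<in> S" if "j < length bs" for j using orthonormal_basis_props(3) that by blast
  then have "matrix_wrt bs f = matrix_wrt bs g"
    using assms(2) by (intro eq_matI) (auto simp: matrix_wrt_def)
  then show ?thesis by (simp add: det_on_def bs_def)
qed

lemma det_on_diagonal:
  assumes bs: "orthonormal_basis S bs" and f: "linear f"
    and diag: "\<And>k. k < length bs \<Longrightarrow> f (bs ! k) = l k *\<^sub>R bs ! k"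
  shows "det_on S f = (\<Prod>k<length bs. l k)"
proof -
  have sub: "subspace S" using bs by (rule orthonormal_basis_imp_subspace)
  have "f x \<in> S" if "x \<in> S" for x
  proof -
    have "f x = (\<Sum>k<length bs. inner (bs ! k) x *\<^sub>R l k *\<^sub>R bs ! k)"
      by (subst orthonormal_basis_props(4)[OF bs that])
        (simp add: linear_sum[OF f] linear_scale[OF f] diag)
    also have "\<dots> \<in> S" using sub orthonormal_basis_props(3)[OF bs]
      by (auto intro!: subspace_sum subspace_scale)
    finally show ?thesis .
  qed
  then have "det_on S f = Determinant.det (matrix_wrt bs f)"
    using f by (intro det_on_eq[OF bs]) auto
  also have "\<dots> = prod_list (diag_mat (matrix_wrt bs f))"
    by (rule det_lower_triangular[of "length bs"])
      (auto simp: matrix_wrt_def diag orthonormal_basis_inner[OF bs])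
  also have "\<dots> = (\<Prod>k<length bs. l k)"
    by (simp add: prod_list_diag_prod matrix_wrt_def diag orthonormal_basis_inner[OF bs]
        lessThan_atLeast0)
  finally show ?thesis .
qed

lemma det_on_id:
  assumes "subspace S" shows "det_on S (\<lambda>x. x) = 1"
proof -
  obtain bs where "orthonormal_basis S bs" using orthonormal_basis_exists[OF assms] by blast
  from det_on_diagonal[OF this, of "\<lambda>x. x" "\<lambda>_. 1"] show ?thesis by (simp add: linear_ident)
qed

lemma det_on_compose:
  assumes S: "subspace S" and f: "linear f" "f ` S \<subseteq> S" and g: "linear g" "g ` S \<subseteq> S"
  shows "det_on S (\<lambda>x. f (g x)) = det_on S f * det_on S g"
proof -
  obtain bs where bs: "orthonormal_basis S bs" using orthonormal_basis_exists[OF S] by blast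
  let ?n = "length bs"
  have fg: "linear (\<lambda>x. f (g x))" "(\<lambda>x. f (g x)) ` S \<subseteq> S"
    using linear_compose[OF g(1) f(1)] f(2) g(2) by (auto simp: o_def)
  have "matrix_wrt bs (\<lambda>x. f (g x)) = matrix_wrt bs f * matrix_wrt bs g"
  proof (rule eq_matI)
    fix i j assume "i < dim_row (matrix_wrt bs f * matrix_wrt bs g)"
      "j < dim_col (matrix_wrt bs f * matrix_wrt bs g)"
    then have ij: "i < ?n" "j < ?n" by (auto simp: matrix_wrt_def)
    have "g (bs ! j) \<in> S" using orthonormal_basis_props(3)[OF bs ij(2)] g(2) by blast
    from orthonormal_basis_props(4)[OF bs this]
    have "inner (bs ! i) (f (g (bs ! j))) =
        inner (bs ! i) (f (\<Sum>k<?n. inner (bs ! k) (g (bs ! j)) *\<^sub>R bs ! k))" by simp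
    also have "\<dots> = (\<Sum>k<?n. inner (bs ! i) (f (bs ! k)) * inner (bs ! k) (g (bs ! j)))"
      by (simp add: linear_sum[OF f(1)] linear_scale[OF f(1)] inner_sum_right mult.commute)
    finally show "matrix_wrt bs (\<lambda>x. f (g x)) $$ (i, j) = (matrix_wrt bs f * matrix_wrt bs g) $$ (i, j)"
      using ij by (simp add: matrix_wrt_def scalar_prod_def lessThan_atLeast0)
  qed (auto simp: matrix_wrt_def)
  moreover have "Determinant.det (matrix_wrt bs f * matrix_wrt bs g) =
      Determinant.det (matrix_wrt bs f) * Determinant.det (matrix_wrt bs g)"
    by (rule det_mult[of _ ?n]) (auto simp: matrix_wrt_def)
  ultimately show ?thesis
    using det_on_eq[OF bs f] det_on_eq[OF bs g] det_on_eq[OF bs fg] by simp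
qed

text \<open>The matrix becomes the transpose. The ambient adjoint may leave \<open>S\<close>, which
  is why it is followed by the projection.\<close>

lemma det_on_adjoint:
  fixes f :: "'a::euclidean_space \<Rightarrow> 'a"
  assumes S: "subspace S" and f: "linear f" "f ` S \<subseteq> S"
  shows "det_on S (\<lambda>x. orth_proj S (adjoint f x)) = det_on S f"
proof -
  obtain bs where bs: "orthonormal_basis S bs" using orthonormal_basis_exists[OF S] by blast
  let ?g = "\<lambda>x. orth_proj S (adjoint f x)"
  have g: "linear ?g" "?g ` S \<subseteq> S"
    using linear_compose[OF adjoint_linear[OF f(1)] orth_proj_linear[OF S]] orth_proj_in[OF S]
    by (auto simp: o_def)
  have "matrix_wrt bs ?g = transpose_mat (matrix_wrt bs f)"
    using orthonormal_basis_props(3)[OF bs]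
    by (intro eq_matI)
      (auto simp: matrix_wrt_def orth_proj_inner2[OF S] adjoint_works[OF f(1)] inner_commute)
  moreover have "Determinant.det (transpose_mat (matrix_wrt bs f)) = Determinant.det (matrix_wrt bs f)"
    by (rule det_transpose[of _ "length bs"]) (auto simp: matrix_wrt_def)
  ultimately show ?thesis
    using det_on_eq[OF bs f] det_on_eq[OF bs g] by simp
qed

text \<open>Parseval in both bases, with \<open>f\<close> moved across the inner product in between.
  Parseval needs only one of its two vectors in \<open>S\<close>, so \<open>f\<close> may lead out
  of \<open>S\<close>.\<close>

lemma trace_basis_independent:
  fixes f :: "'a::euclidean_space \<Rightarrow> 'a"
  assumes bs: "orthonormal_basis S bs" and cs: "orthonormal_basis S cs" and f: "linear f"
  shows "(\<Sum>k<length bs. inner (bs ! k) (f (bs ! k))) = (\<Sum>k<length cs. inner (cs ! k) (f (cs ! k)))"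
proof -
  have "(\<Sum>k<length bs. inner (bs ! k) (f (bs ! k))) =
      (\<Sum>k<length bs. \<Sum>l<length cs. inner (cs ! l) (bs ! k) * inner (adjoint f (cs ! l)) (bs ! k))"
    using orthonormal_basis_props(3)[OF bs]
    by (simp add: orthonormal_basis_Parseval[OF cs] inner_commute[of "adjoint f _"]
        adjoint_works[OF f] inner_commute[of "f _"])
  also have "\<dots> = (\<Sum>l<length cs. inner (cs ! l) (adjoint f (cs ! l)))"
    using orthonormal_basis_props(3)[OF cs]
    by (subst sum.swap) (simp add: orthonormal_basis_Parseval[OF bs] inner_commute)
  finally show ?thesis by (simp add: adjoint_works[OF f] inner_commute)
qed

lemma selfadjoint_onD:
  assumes "selfadjoint_on S f"
  shows "linear f" "x \<in> S \<Longrightarrow> f x \<in> S" "x \<in> S \<Longrightarrow> y \<in> S \<Longrightarrow> inner (f x) y = inner x (f y)"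
  using assms unfolding selfadjoint_on_def by auto

lemma posdef_onD:
  assumes "posdef_on S f"
  shows "selfadjoint_on S f" "x \<in> S \<Longrightarrow> x \<noteq> 0 \<Longrightarrow> 0 < inner (f x) x"
  using assms unfolding posdef_on_def by auto

lemma diagonal_quadratic_form:
  assumes bs: "orthonormal_basis S bs" and f: "linear f"
    and diag: "\<And>k. k < length bs \<Longrightarrow> f (bs ! k) = l k *\<^sub>R bs ! k" and x: "x \<in> S"
  shows "inner (f x) y = (\<Sum>k<length bs. l k * (inner (bs ! k) x * inner (bs ! k) y))"
proof -
  have "f x = (\<Sum>k<length bs. inner (bs ! k) x *\<^sub>R l k *\<^sub>R bs ! k)"
    by (subst orthonormal_basis_props(4)[OF bs x])
      (simp add: linear_sum[OF f] linear_scale[OF f] diag)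
  then show ?thesis by (simp add: inner_sum_left algebra_simps)
qed

lemma posdef_diagonalizable:
  assumes S: "subspace S" and f: "posdef_on S f"
  obtains bs l where "orthonormal_basis S bs"
    "\<And>k. k < length bs \<Longrightarrow> f (bs ! k) = l k *\<^sub>R bs ! k"
    "\<And>k. k < length bs \<Longrightarrow> 0 < l k"
    "det_on S f = (\<Prod>k<length bs. l k)"
proof -
  note sa = posdef_onD(1)[OF f]
  obtain bs l where bs: "orthonormal_basis S bs"
    and diag: "\<And>k. k < length bs \<Longrightarrow> f (bs ! k) = l k *\<^sub>R bs ! k"
    by (rule selfadjoint_diagonalizable[OF S sa]) blast
  have "0 < l k" if k: "k < length bs" for k
  proof -
    have "inner (bs ! k) (bs ! k) = 1" using orthonormal_basis_inner[OF bs k k] by simp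
    then show ?thesis
      using posdef_onD(2)[OF f orthonormal_basis_props(3)[OF bs k]] diag[OF k] by force
  qed
  then show thesis using that bs diag det_on_diagonal[OF bs selfadjoint_onD(1)[OF sa] diag]
    by blast
qed

lemma posdef_det_on_pos:
  assumes "subspace S" "posdef_on S f" shows "0 < det_on S f"
  by (rule posdef_diagonalizable[OF assms]) (auto intro: prod_pos)

lemma posdef_on_id: "posdef_on S (\<lambda>x. x)"
  by (auto simp: posdef_on_def selfadjoint_on_def linear_ident)

section \<open>Quadratic forms of a datum\<close>

locale datum =
  fixes E :: "'k::finite \<Rightarrow> 'a::euclidean_space set"
    and F :: "'m::finite \<Rightarrow> 'b::euclidean_space set"
    and c :: "'k \<Rightarrow> real" and d :: "'m \<Rightarrow> real"
    and B :: "'k \<Rightarrow> 'm \<Rightarrow> 'a \<Rightarrow> 'b"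
  assumes datum: "is_datum E F c d B"
begin

abbreviation "P i \<equiv> orth_proj (E i)"
abbreviation "E0 \<equiv> direct_sum E"
abbreviation "Q \<equiv> Q_map E c B"

lemma subE [simp]: "subspace (E i)" and subF [simp]: "subspace (F j)"
  and ortho: "i \<noteq> i' \<Longrightarrow> x \<in> E i \<Longrightarrow> y \<in> E i' \<Longrightarrow> inner x y = 0"
  and cpos: "0 < c i" and dpos: "0 < d j"
  and linB: "linear (B i j)" and BF: "x \<in> E i \<Longrightarrow> B i j x \<in> F j"
  and dims: "(\<Sum>i\<in>UNIV. c i * real (dim (E i))) = (\<Sum>j\<in>UNIV. d j * real (dim (F j)))"
  using datum by (auto simp: is_datum_def image_subset_iff)

lemma subE0 [simp]: "subspace E0" by (simp add: direct_sum_def)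

lemma E_E0: "x \<in> E i \<Longrightarrow> x \<in> E0" unfolding direct_sum_def by (rule span_base) blast

lemma P_in [simp]: "P i x \<in> E i" by (simp add: orth_proj_in)

lemma P_E0 [simp]: "P i x \<in> E0" using E_E0 P_in by blast

lemma P_E: "x \<in> E i' \<Longrightarrow> P i x = (if i = i' then x else 0)"
  using ortho[of i' i x] by (auto simp: orth_proj_id intro!: orth_proj_zero)

lemma linP: "linear (P i)" by (simp add: orth_proj_linear)

lemma P_sum:
  assumes "\<And>i. f i \<in> E i" shows "P i (\<Sum>i\<in>UNIV. f i) = f i"
  by (simp add: linear_sum[OF linP] P_E[OF assms])

lemma E0_sum: assumes "x \<in> E0" shows "(\<Sum>i\<in>UNIV. P i x) = x"
proof -
  have "x \<in> span (\<Union>i. E i)" using assms by (simp add: direct_sum_def)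
  then show ?thesis
  proof (induction rule: span_induct)
    case base
    show ?case
      by (auto simp: subspace_def linear_0[OF linP] linear_add[OF linP] linear_scale[OF linP]
          sum.distrib simp flip: scaleR_sum_right)
  next
    case (step x)
    then show ?case by (auto simp: P_E)
  qed
qed

lemma P_orth_proj_E0: "P i (orth_proj E0 x) = P i x"
proof -
  have "P i (x - orth_proj E0 x) = 0"
    using E_E0 by (auto intro!: orth_proj_zero simp: inner_diff_left orth_proj_inner)
  then show ?thesis by (simp add: linear_diff[OF linP])
qed

lemma inner_P: "inner (P i x) y = inner (P i x) (P i y)"
  by (simp add: orth_proj_inner2)

lemma Lambda_eq: "Lambda E c x = (\<Sum>i\<in>UNIV. c i *\<^sub>R P i x)"
  by (simp add: Lambda_def weighted_sum_def)

lemma lin_Lambda: "linear (Lambda E c)"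
  by (auto intro!: linearI simp: Lambda_eq linear_add[OF linP] linear_scale[OF linP]
      scaleR_add_right sum.distrib scaleR_sum_right mult.commute)

lemma Lambda_selfadjoint: "inner (Lambda E c x) y = inner x (Lambda E c y)"
  by (simp add: Lambda_eq inner_sum_left inner_sum_right orth_proj_selfadjoint)

lemma Lambda_in: "Lambda E c x \<in> E0"
  by (auto simp: Lambda_eq intro!: subspace_sum subspace_scale)

lemma lin_total: "linear (total_map E B j)"
  by (auto intro!: linearI simp: total_map_def linear_add[OF linP] linear_scale[OF linP]
      linear_add[OF linB] linear_scale[OF linB] sum.distrib scaleR_sum_right)

lemma total_in: "total_map E B j x \<in> F j"
  by (auto simp: total_map_def intro!: subspace_sum BF)

lemma linQ: "linear (Q j)"
  using linear_compose[OF lin_Lambda lin_total] by (simp add: Q_map_def[abs_def] o_def)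

lemma Q_in: "Q j x \<in> F j" by (simp add: Q_map_def total_in)

lemma Q_orth_proj_E0: "Q j (orth_proj E0 x) = Q j x"
  by (simp add: Q_map_def Lambda_eq P_orth_proj_E0)

lemma adjQ: "inner x (adjoint (Q j) y) = inner (Q j x) y" "inner (adjoint (Q j) y) x = inner y (Q j x)"
  by (simp_all add: adjoint_works[OF linQ] adjoint_clauses[OF linQ])

lemma lin_adjQ: "linear (adjoint (Q j))" by (simp add: adjoint_linear linQ)

text \<open>\<open>Q j\<close> factors through the projection onto \<open>E0\<close>; dually, its
  adjoint is fixed by this projection.\<close>

lemma adjQ_in: "adjoint (Q j) y \<in> E0"
proof -
  have "inner x (orth_proj E0 (adjoint (Q j) y)) = inner x (adjoint (Q j) y)" for x
    by (simp add: orth_proj_selfadjoint[symmetric] adjQ Q_orth_proj_E0)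
  then have "orth_proj E0 (adjoint (Q j) y) = adjoint (Q j) y"
    by (metis inner_commute vector_eq_rdot)
  then show ?thesis by (metis orth_proj_in subE0)
qed

lemma quadratic_form_lhs:
  "inner (\<Sum>j\<in>UNIV. d j *\<^sub>R
      Lambda E c (adjoint (total_map E B j) (U j (total_map E B j (Lambda E c x))))) y
    = (\<Sum>j\<in>UNIV. d j * inner (U j (Q j x)) (Q j y))"
  by (simp add: inner_sum_left Lambda_selfadjoint adjoint_clauses[OF lin_total] Q_map_def)

text \<open>Both quadratic forms depend on \<open>x\<close> only through its projection to
  \<open>E0\<close>. So the operator inequality on \<open>E0\<close> can be tested on all ambient
  vectors, which spares membership conditions later.\<close>

lemma gauss_feasible_iff:
  "gauss_feasible E F c d B V U \<longleftrightarrow>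
     (\<forall>i. posdef_on (E i) (V i)) \<and> (\<forall>j. posdef_on (F j) (U j)) \<and>
     (\<forall>x. (\<Sum>j\<in>UNIV. d j * inner (U j (Q j x)) (Q j x)) \<le> (\<Sum>i\<in>UNIV. c i * inner (V i (P i x)) (P i x)))"
  (is "_ \<longleftrightarrow> ?V \<and> ?U \<and> (\<forall>x. ?l x \<le> ?r x)")
proof (cases "?V \<and> ?U")
  case True
  then have V: "selfadjoint_on (E i) (V i)" and U: "selfadjoint_on (F j) (U j)" for i j
    by (auto simp: posdef_on_def)
  let ?f = "\<lambda>x. \<Sum>j\<in>UNIV. d j *\<^sub>R
    Lambda E c (adjoint (total_map E B j) (U j (total_map E B j (Lambda E c x))))"
  let ?g = "weighted_sum E c V"
  have g: "inner (?g x) y = (\<Sum>i\<in>UNIV. c i * inner (V i (P i x)) (P i y))" for x y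
    using selfadjoint_onD(2)[OF V P_in]
    by (simp add: weighted_sum_def inner_sum_left orth_proj_inner2)
  have lin: "linear (\<lambda>x. ?g x - ?f x)"
  proof -
    have lv: "linear (V i)" and lu: "linear (U j)" for i j using V U selfadjoint_onD(1) by blast+
    note l = linP lv lin_Lambda lin_total lu adjoint_linear[OF lin_total]
    note add = l[THEN linear_add] and scale = l[THEN linear_scale]
    show ?thesis
      unfolding weighted_sum_def
    proof (intro linear_compose_sub)
      show "linear (\<lambda>x. \<Sum>i\<in>UNIV. c i *\<^sub>R V i (P i x))"
        by (rule linearI) (simp_all add: add scale scaleR_add_right sum.distrib scaleR_sum_right mult.commute)
      show "linear ?f"
        by (rule linearI) (simp_all add: add scale scaleR_add_right sum.distrib scaleR_sum_right mult.commute)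
    qed
  qed
  have "selfadjoint_on E0 (\<lambda>x. ?g x - ?f x)"
    unfolding selfadjoint_on_def
  proof (intro conjI ballI lin)
    show "(\<lambda>x. ?g x - ?f x) ` E0 \<subseteq> E0"
      unfolding weighted_sum_def
      using E_E0[OF selfadjoint_onD(2)[OF V P_in]]
      by (auto intro!: subspace_diff subspace_sum subspace_scale Lambda_in)
    show "inner (?g x - ?f x) y = inner x (?g y - ?f y)" for x y
      unfolding inner_diff_left inner_diff_right inner_commute[of x] quadratic_form_lhs g
      using selfadjoint_onD(3)[OF U Q_in Q_in] selfadjoint_onD(3)[OF V P_in P_in]
      by (simp add: inner_commute)
  qed
  then have "op_le_on E0 ?f ?g \<longleftrightarrow> (\<forall>x\<in>E0. ?l x \<le> ?r x)"
    unfolding op_le_on_def possemidef_on_def inner_diff_left quadratic_form_lhs g by simp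
  also have "\<dots> \<longleftrightarrow> (\<forall>x. ?l x \<le> ?r x)"
  proof safe
    fix x assume "\<forall>x\<in>E0. ?l x \<le> ?r x"
    from bspec[OF this orth_proj_in[OF subE0, of x]]
    show "?l x \<le> ?r x" by (simp add: Q_orth_proj_E0 P_orth_proj_E0)
  qed blast
  finally show ?thesis using True unfolding gauss_feasible_def by simp
qed (auto simp: gauss_feasible_def)

lemma adjoint_Q_eq: "adjoint (Q j) y = Lambda E c (adjoint (total_map E B j) y)"
proof -
  have "inner x (adjoint (Q j) y) = inner x (Lambda E c (adjoint (total_map E B j) y))" for x
    by (simp add: adjQ Q_map_def adjoint_works[OF lin_total] flip: Lambda_selfadjoint)
  then show ?thesis by (metis inner_commute vector_eq_rdot)
qed

lemma gauss_feasible_id_iff: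
  "gauss_feasible E F c d B (\<lambda>i x. x) (\<lambda>j y. y) \<longleftrightarrow>
   op_le_on E0 (\<lambda>x. \<Sum>j\<in>UNIV. d j *\<^sub>R adjoint (Q j) (Q j x)) (Lambda E c)"
  unfolding gauss_feasible_def Lambda_def[symmetric] adjoint_Q_eq
  by (simp add: Q_map_def posdef_on_id)

end

section \<open>Interpolation and geometric data\<close>

text \<open>The operators are already diagonalised: eigenvalues have become the weights
  \<open>u\<close>, \<open>v\<close>, and the pairs of a summand and an eigenvector have been merged
  into the index sets \<open>I\<close>, \<open>J\<close>. The exponent 1/2 is halfway between the
  two hypotheses, so \<open>2ab <= a^2 + b^2\<close> splits each term into one part for each of
  them.\<close>

lemma interpolate_sqrt:
  fixes S :: "'a::euclidean_space set" and e :: "'p \<Rightarrow> 'a" and q :: "'q \<Rightarrow> 'a"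
  assumes fin: "finite I" "finite J" and S: "subspace S"
    and e: "\<And>i. i \<in> I \<Longrightarrow> e i \<in> S"
      "\<And>i i'. i \<in> I \<Longrightarrow> i' \<in> I \<Longrightarrow> inner (e i) (e i') = (if i = i' then 1 else 0)"
      "\<And>x. x \<in> S \<Longrightarrow> (\<Sum>i\<in>I. inner (e i) x *\<^sub>R e i) = x"
    and pos: "\<And>i. i \<in> I \<Longrightarrow> 0 < c i" "\<And>i. i \<in> I \<Longrightarrow> 0 < v i"
      "\<And>j. j \<in> J \<Longrightarrow> 0 < d j" "\<And>j. j \<in> J \<Longrightarrow> 0 < u j"
    and le: "\<And>x. x \<in> S \<Longrightarrow> (\<Sum>j\<in>J. d j * u j * (inner (q j) x)\<^sup>2) \<le> (\<Sum>i\<in>I. c i * v i * (inner (e i) x)\<^sup>2)"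
      "\<And>x. x \<in> S \<Longrightarrow> (\<Sum>j\<in>J. d j * (inner (q j) x)\<^sup>2) \<le> (\<Sum>i\<in>I. c i * (inner (e i) x)\<^sup>2)"
    and x: "x \<in> S"
  shows "(\<Sum>j\<in>J. d j * sqrt (u j) * (inner (q j) x)\<^sup>2) \<le> (\<Sum>i\<in>I. c i * sqrt (v i) * (inner (e i) x)\<^sup>2)"
proof (cases "x = 0")
  case False
  define X where "X x y = (\<Sum>j\<in>J. d j * sqrt (u j) * (inner (q j) x * inner (q j) y))" for x y
  define N where "N x y = (\<Sum>i\<in>I. c i * sqrt (v i) * (inner (e i) x * inner (e i) y))" for x y
  have bil: "bilinear X" "bilinear N"
    by (auto simp: bilinear_def linear_iff X_def N_def inner_add_right algebra_simps
        sum.distrib sum_distrib_left)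
  have sym: "X x y = X y x" "N x y = N y x" for x y by (auto simp: X_def N_def mult.commute)
  have weighted_pos: "0 < (\<Sum>i\<in>I. w i * (inner (e i) y)\<^sup>2)"
    if "y \<in> S" "y \<noteq> 0" and w: "\<And>i. i \<in> I \<Longrightarrow> 0 < w i" for w y
  proof -
    have "\<exists>i\<in>I. inner (e i) y \<noteq> 0"
    proof (rule ccontr)
      assume "\<not> ?thesis"
      then have "(\<Sum>i\<in>I. inner (e i) y *\<^sub>R e i) = 0" by simp
      then show False using e(3)[OF that(1)] that(2) by simp
    qed
    then obtain i where i: "i \<in> I" "inner (e i) y \<noteq> 0" by blast
    show ?thesis
      by (rule sum_pos2[OF fin(1) i(1)]) (use i w in \<open>auto simp: less_imp_le\<close>)
  qed
  have Npos: "0 < N y y" if "y \<in> S" "y \<noteq> 0" for y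
    using weighted_pos[OF that, of "\<lambda>i. c i * sqrt (v i)"] pos by (simp add: N_def power2_eq_square)
  obtain z l where z: "z \<in> S" "z \<noteq> 0" "\<And>y. y \<in> S \<Longrightarrow> X z y = l * N z y"
    and l: "\<And>y. y \<in> S \<Longrightarrow> X y y \<le> l * N y y"
    by (rule rayleigh_eigenvector[OF S x False bil(1) sym(1) bil(2) sym(2) Npos]) blast+
  txt \<open>Testing the top eigenvector \<open>z\<close> of \<open>X\<close> relative to \<open>N\<close> against \<open>\<surd>v z\<close> bounds the
    eigenvalue by 1.\<close>
  define M where "M = (\<Sum>i\<in>I. c i * v i * (inner (e i) z)\<^sup>2)"
  define y where "y = (\<Sum>i\<in>I. (sqrt (v i) * inner (e i) z) *\<^sub>R e i)"
  have y: "y \<in> S" using S e(1) by (auto simp: y_def intro!: subspace_sum subspace_scale)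
  have ey: "inner (e i) y = sqrt (v i) * inner (e i) z" if "i \<in> I" for i
  proof -
    have "inner (e i) y = (\<Sum>k\<in>I. (sqrt (v k) * inner (e k) z) * (if i = k then 1 else 0))"
      unfolding y_def inner_sum_right using e(2) that by (intro sum.cong) auto
    then show ?thesis using fin(1) that by (simp add: if_distrib cong: if_cong)
  qed
  have "M > 0"
    using weighted_pos[OF z(1,2), of "\<lambda>i. c i * v i"] pos by (simp add: M_def)
  moreover have "l * M = X z y"
  proof -
    have "N z y = M"
      unfolding N_def M_def using pos(2)
      by (intro sum.cong) (auto simp: ey power2_eq_square less_imp_le algebra_simps
          simp flip: real_sqrt_mult)
    then show ?thesis using z(3)[OF y] by simp
  qed
  \<comment> \<open>The first squares are bounded by the weighted hypothesis at \<open>z\<close>,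
    the second by the unweighted one at \<open>y\<close>. The choice of \<open>y\<close> makes both
    bounds equal to \<open>M\<close>.\<close>
  moreover have "X z y \<le> M"
  proof -
    have "2 * (d j * sqrt (u j) * (inner (q j) z * inner (q j) y))
        \<le> d j * u j * (inner (q j) z)\<^sup>2 + d j * (inner (q j) y)\<^sup>2" if "j \<in> J" for j
    proof -
      have "0 \<le> d j * (sqrt (u j) * inner (q j) z - inner (q j) y)\<^sup>2" using pos(3)[OF that] by simp
      also have "\<dots> = d j * ((sqrt (u j))\<^sup>2 * (inner (q j) z)\<^sup>2) + d j * (inner (q j) y)\<^sup>2
          - 2 * (d j * sqrt (u j) * (inner (q j) z * inner (q j) y))"
        by (simp add: power2_eq_square algebra_simps)
      finally show ?thesis using pos(4)[OF that] by (simp add: mult.assoc)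
    qed
    then have "2 * X z y \<le> (\<Sum>j\<in>J. d j * u j * (inner (q j) z)\<^sup>2) + (\<Sum>j\<in>J. d j * (inner (q j) y)\<^sup>2)"
      unfolding X_def sum_distrib_left sum.distrib[symmetric] by (rule sum_mono)
    also have "\<dots> \<le> M + (\<Sum>i\<in>I. c i * (inner (e i) y)\<^sup>2)"
      unfolding M_def using le z(1) y by (intro add_mono) auto
    also have "(\<Sum>i\<in>I. c i * (inner (e i) y)\<^sup>2) = M"
      unfolding M_def using pos(2)
      by (intro sum.cong) (auto simp: ey power_mult_distrib less_imp_le)
    finally show ?thesis by simp
  qed
  ultimately have "l \<le> 1" using mult_le_cancel_right[of l M 1] by simp
  then have "l * N x x \<le> N x x" using Npos[OF x False] by simp
  then show ?thesis using l[OF x] by (simp add: X_def N_def power2_eq_square)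
qed simp

text \<open>Every halving keeps the unweighted inequality as the endpoint of exponent 0 and replaces
  the other endpoint by the inequality just obtained.\<close>

lemma interpolate_dyadic:
  fixes S :: "'a::euclidean_space set" and e :: "'p \<Rightarrow> 'a" and q :: "'q \<Rightarrow> 'a"
  assumes fin: "finite I" "finite J" and S: "subspace S"
    and e: "\<And>i. i \<in> I \<Longrightarrow> e i \<in> S"
      "\<And>i i'. i \<in> I \<Longrightarrow> i' \<in> I \<Longrightarrow> inner (e i) (e i') = (if i = i' then 1 else 0)"
      "\<And>x. x \<in> S \<Longrightarrow> (\<Sum>i\<in>I. inner (e i) x *\<^sub>R e i) = x"
    and pos: "\<And>i. i \<in> I \<Longrightarrow> 0 < c i" "\<And>i. i \<in> I \<Longrightarrow> 0 < v i"
      "\<And>j. j \<in> J \<Longrightarrow> 0 < d j" "\<And>j. j \<in> J \<Longrightarrow> 0 < u j"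
    and le: "\<And>x. x \<in> S \<Longrightarrow> (\<Sum>j\<in>J. d j * u j * (inner (q j) x)\<^sup>2) \<le> (\<Sum>i\<in>I. c i * v i * (inner (e i) x)\<^sup>2)"
      "\<And>x. x \<in> S \<Longrightarrow> (\<Sum>j\<in>J. d j * (inner (q j) x)\<^sup>2) \<le> (\<Sum>i\<in>I. c i * (inner (e i) x)\<^sup>2)"
    and x: "x \<in> S"
  shows "(\<Sum>j\<in>J. d j * u j powr (1 / 2 ^ n) * (inner (q j) x)\<^sup>2)
    \<le> (\<Sum>i\<in>I. c i * v i powr (1 / 2 ^ n) * (inner (e i) x)\<^sup>2)"
  using x
proof (induction n arbitrary: x)
  case 0
  then show ?case using le(1)[OF 0] pos by (simp add: less_imp_le)
next
  case (Suc n)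
  have half: "sqrt (t powr (1 / 2 ^ n)) = t powr (1 / 2 ^ Suc n)" if "0 < t" for t :: real
    using that by (subst powr_half_sqrt[symmetric]) (simp_all add: powr_powr mult.commute)
  have "(\<Sum>j\<in>J. d j * sqrt (u j powr (1 / 2 ^ n)) * (inner (q j) x)\<^sup>2)
    \<le> (\<Sum>i\<in>I. c i * sqrt (v i powr (1 / 2 ^ n)) * (inner (e i) x)\<^sup>2)"
  proof (rule interpolate_sqrt[OF fin S e pos(1) _ pos(3) _ _ le(2) Suc.prems])
  qed (use pos in \<open>fastforce intro: Suc.IH\<close>)+
  then show ?case using pos(2,4) by (simp add: half)
qed

text \<open>Exchanging the summations reorders a weighted sum of values of a diagonal quadratic form
  by eigenvectors, so that information about the family \<open>p\<close> can be used at each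
  eigenvector separately.\<close>

lemma weighted_sum_swap:
  assumes "\<And>j. j \<in> A \<Longrightarrow> f (p j) = (\<Sum>k<length bs. l k * (inner (p j) (bs ! k))\<^sup>2)"
  shows "(\<Sum>j\<in>A. w j * f (p j)) = (\<Sum>k<length bs. l k * (\<Sum>j\<in>A. w j * (inner (p j) (bs ! k))\<^sup>2))"
    (is "_ = ?r")
proof -
  have "?r = (\<Sum>j\<in>A. \<Sum>k<length bs. l k * (w j * (inner (p j) (bs ! k))\<^sup>2))"
    unfolding sum_distrib_left by (rule sum.swap)
  then show ?thesis using assms by (simp add: sum_distrib_left mult.left_commute)
qed

text \<open>In operator terms, A <= B implies tr(TA) <= tr(TB) for positive semidefinite
  \<open>T\<close>: evaluate the inequality at the eigenvectors of \<open>T\<close> and add up with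
  the nonnegative eigenvalues as weights.\<close>

lemma possemidef_trace_mono:
  fixes S :: "'a::euclidean_space set"
  assumes S: "subspace S" and T: "possemidef_on S T"
    and e: "\<And>i. i \<in> I \<Longrightarrow> e i \<in> S" and q: "\<And>j. j \<in> J \<Longrightarrow> q j \<in> S"
    and le: "\<And>x. x \<in> S \<Longrightarrow> (\<Sum>j\<in>J. u j * (inner (q j) x)\<^sup>2) \<le> (\<Sum>i\<in>I. v i * (inner (e i) x)\<^sup>2)"
  shows "(\<Sum>j\<in>J. u j * inner (T (q j)) (q j)) \<le> (\<Sum>i\<in>I. v i * inner (T (e i)) (e i))"
proof -
  have sa: "selfadjoint_on S T" and nn: "\<And>x. x \<in> S \<Longrightarrow> 0 \<le> inner (T x) x"
    using T by (auto simp: possemidef_on_def)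
  obtain bs l where bs: "orthonormal_basis S bs"
    and diag: "\<And>k. k < length bs \<Longrightarrow> T (bs ! k) = l k *\<^sub>R bs ! k"
    by (rule selfadjoint_diagonalizable[OF S sa]) blast
  have bsS: "bs ! k \<in> S" if "k < length bs" for k using orthonormal_basis_props(3)[OF bs that] .
  have l: "0 \<le> l k" if "k < length bs" for k
    using nn[OF bsS[OF that]] diag[OF that] orthonormal_basis_inner[OF bs that that] by simp
  have form: "inner (T x) x = (\<Sum>k<length bs. l k * (inner x (bs ! k))\<^sup>2)" if "x \<in> S" for x
    using diagonal_quadratic_form[OF bs selfadjoint_onD(1)[OF sa] diag that, of x]
    by (simp add: power2_eq_square inner_commute)
  have "(\<Sum>k<length bs. l k * (\<Sum>j\<in>J. u j * (inner (q j) (bs ! k))\<^sup>2))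
      \<le> (\<Sum>k<length bs. l k * (\<Sum>i\<in>I. v i * (inner (e i) (bs ! k))\<^sup>2))"
    using l le[OF bsS] by (auto intro!: sum_mono mult_left_mono)
  then show ?thesis
    using weighted_sum_swap[of J "\<lambda>x. inner (T x) x" q l bs u] weighted_sum_swap[of I "\<lambda>x. inner (T x) x" e l bs v]
    by (simp add: form e q)
qed

lemma powr_dyadic_tendsto_ln:
  fixes u :: real assumes "0 < u"
  shows "(\<lambda>n. (u powr (1 / 2 ^ n) - 1) / (1 / 2 ^ n)) \<longlonglongrightarrow> ln u"
proof -
  have "((\<lambda>s. u powr s) has_real_derivative ln u) (at 0)"
    using assms by (auto intro!: derivative_eq_intros)
  then have "((\<lambda>s. (u powr s - 1) / s) \<longlongrightarrow> ln u) (at 0)"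
    using assms by (simp add: DERIV_def)
  moreover have "filterlim (\<lambda>n. 1 / 2 ^ n :: real) (at 0) sequentially"
    by (auto simp: filterlim_at intro!: LIMSEQ_divide_realpow_zero)
  ultimately show ?thesis by (rule filterlim_compose)
qed

lemma sum_difference_quotient:
  fixes s :: real
  shows "(\<Sum>j\<in>A. w j * ((t j powr s - 1) / s)) = ((\<Sum>j\<in>A. w j * t j powr s) - (\<Sum>j\<in>A. w j)) / s"
  by (simp add: sum_subtractf sum_divide_distrib right_diff_distrib diff_divide_distrib)

text \<open>By \<open>eq\<close> the two sides agree at exponent 0, so the inequality passes to the
  difference quotients at 0, whose limits are the logarithmic sums.\<close>

lemma sum_powr_le_imp_sum_ln_le:
  fixes u :: "'q \<Rightarrow> real" and v :: "'p \<Rightarrow> real"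
  assumes pos: "\<And>j. j \<in> J \<Longrightarrow> 0 < u j" "\<And>i. i \<in> I \<Longrightarrow> 0 < v i"
    and eq: "(\<Sum>j\<in>J. d j) = (\<Sum>i\<in>I. c i)"
    and le: "\<And>n. (\<Sum>j\<in>J. d j * u j powr (1 / 2 ^ n)) \<le> (\<Sum>i\<in>I. c i * v i powr (1 / 2 ^ n))"
  shows "(\<Sum>j\<in>J. d j * ln (u j)) \<le> (\<Sum>i\<in>I. c i * ln (v i))"
proof (rule LIMSEQ_le)
  let ?s = "\<lambda>n. 1 / 2 ^ n :: real"
  show "(\<lambda>n. \<Sum>j\<in>J. d j * ((u j powr ?s n - 1) / ?s n)) \<longlonglongrightarrow> (\<Sum>j\<in>J. d j * ln (u j))"
    by (intro tendsto_sum tendsto_mult tendsto_const powr_dyadic_tendsto_ln pos)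
  show "(\<lambda>n. \<Sum>i\<in>I. c i * ((v i powr ?s n - 1) / ?s n)) \<longlonglongrightarrow> (\<Sum>i\<in>I. c i * ln (v i))"
    by (intro tendsto_sum tendsto_mult tendsto_const powr_dyadic_tendsto_ln pos)
  have "(\<Sum>j\<in>J. d j * ((u j powr ?s n - 1) / ?s n)) \<le> (\<Sum>i\<in>I. c i * ((v i powr ?s n - 1) / ?s n))" for n
    using le[of n] eq unfolding sum_difference_quotient by (simp add: divide_right_mono)
  then show "\<exists>N. \<forall>n\<ge>N. (\<Sum>j\<in>J. d j * ((u j powr ?s n - 1) / ?s n))
      \<le> (\<Sum>i\<in>I. c i * ((v i powr ?s n - 1) / ?s n))" by blast
qed

lemma sum_Sigma_lessThan:
  fixes n :: "'k::finite \<Rightarrow> nat"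
  shows "(\<Sum>p\<in>(SIGMA i:UNIV. {..<n i}). g p) = (\<Sum>i\<in>UNIV. \<Sum>k<n i. g (i, k))"
  by (simp add: sum.Sigma split_def)

lemma posdef_family_diagonalizable:
  assumes "\<And>i. subspace (S i)" "\<And>i. posdef_on (S i) (f i)"
  obtains bs l where "\<And>i. orthonormal_basis (S i) (bs i)"
    "\<And>i k. k < length (bs i) \<Longrightarrow> f i (bs i ! k) = l i k *\<^sub>R bs i ! k"
    "\<And>i k. k < length (bs i) \<Longrightarrow> 0 < l i k"
    "\<And>i. det_on (S i) (f i) = (\<Prod>k<length (bs i). l i k)"
proof -
  have "\<exists>b l. orthonormal_basis (S i) b \<and> (\<forall>k<length b. f i (b ! k) = l k *\<^sub>R b ! k \<and> 0 < l k) \<and>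
      det_on (S i) (f i) = (\<Prod>k<length b. l k)" for i
    by (rule posdef_diagonalizable[OF assms(1)[of i] assms(2)[of i]]) blast
  then obtain bs l where "\<forall>i. orthonormal_basis (S i) (bs i) \<and>
      (\<forall>k<length (bs i). f i (bs i ! k) = l i k *\<^sub>R bs i ! k \<and> 0 < l i k) \<and>
      det_on (S i) (f i) = (\<Prod>k<length (bs i). l i k)"
    by metis
  then show thesis using that[of bs l] by blast
qed

section \<open>Geometric data are extremized by the identity\<close>

context datum
begin

lemma geometric_value_nonpos:
  assumes geo: "geometric E F c d B" and feas: "gauss_feasible E F c d B V U"
  shows "(\<Sum>j\<in>UNIV. d j * ln (det_on (F j) (U j))) \<le> (\<Sum>i\<in>UNIV. c i * ln (det_on (E i) (V i)))"
proof -
  note feas' = feas[unfolded gauss_feasible_iff]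
  have V: "posdef_on (E i) (V i)" and U: "posdef_on (F j) (U j)" for i j using feas' by blast+
  have linV: "linear (V i)" and linU: "linear (U j)" for i j
    using posdef_onD(1)[OF V] posdef_onD(1)[OF U] selfadjoint_onD(1) by blast+
  obtain T where T: "possemidef_on E0 T" "\<And>i x. x \<in> E i \<Longrightarrow> inner (T x) x = inner x x"
    and QT: "\<And>j y. y \<in> F j \<Longrightarrow> Q j (T (adjoint (Q j) y)) = y"
    and id: "gauss_feasible E F c d B (\<lambda>i x. x) (\<lambda>j y. y)"
    using geo unfolding geometric_def id_couplings_def gauss_feasible_id_iff by blast
  obtain eb v where eb: "\<And>i. orthonormal_basis (E i) (eb i)"
    and v: "\<And>i k. k < length (eb i) \<Longrightarrow> V i (eb i ! k) = v i k *\<^sub>R eb i ! k"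
      "\<And>i k. k < length (eb i) \<Longrightarrow> 0 < v i k" "\<And>i. det_on (E i) (V i) = (\<Prod>k<length (eb i). v i k)"
    using posdef_family_diagonalizable[of E V, OF subE V] by blast
  obtain fb u where fb: "\<And>j. orthonormal_basis (F j) (fb j)"
    and u: "\<And>j k. k < length (fb j) \<Longrightarrow> U j (fb j ! k) = u j k *\<^sub>R fb j ! k"
      "\<And>j k. k < length (fb j) \<Longrightarrow> 0 < u j k" "\<And>j. det_on (F j) (U j) = (\<Prod>k<length (fb j). u j k)"
    using posdef_family_diagonalizable[of F U, OF subF U] by blast
  \<comment> \<open>One index per eigenvector. The vectors \<open>q\<close> are pulled back by the
    adjoint of \<open>Q j\<close>, so that their inner products with \<open>x\<close> are the
    coordinates of \<open>Q j x\<close> in an eigenbasis of \<open>U j\<close>.\<close>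
  define I where "I = (SIGMA i:UNIV. {..<length (eb i)})"
  define J where "J = (SIGMA j:UNIV. {..<length (fb j)})"
  define e where "e p = eb (fst p) ! snd p" for p
  define q where "q p = adjoint (Q (fst p)) (fb (fst p) ! snd p)" for p
  have fin: "finite I" "finite J" by (auto simp: I_def J_def)
  have eE: "e p \<in> E (fst p)" if "p \<in> I" for p
    using that orthonormal_basis_props(3)[OF eb] by (auto simp: I_def e_def)
  have fbF: "fb (fst p) ! snd p \<in> F (fst p)" if "p \<in> J" for p
    using that orthonormal_basis_props(3)[OF fb] by (auto simp: J_def)
  have eE0: "e p \<in> E0" if "p \<in> I" for p using E_E0 eE[OF that] by blast
  have qE0: "q p \<in> E0" for p by (simp add: q_def adjQ_in)
  have ort: "inner (e p) (e p') = (if p = p' then 1 else 0)" if "p \<in> I" "p' \<in> I" for p p'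
  proof (cases "fst p = fst p'")
    case True
    then show ?thesis using that orthonormal_basis_inner[OF eb, of "snd p" "fst p" "snd p'"]
      by (auto simp: e_def I_def prod_eq_iff)
  next
    case False
    then show ?thesis using ortho[OF False eE eE] that by auto
  qed
  have expand: "(\<Sum>p\<in>I. inner (e p) x *\<^sub>R e p) = x" if "x \<in> E0" for x
    using E0_sum[OF that] by (simp add: I_def sum_Sigma_lessThan e_def orth_proj_basis[OF eb])
  have eP: "inner (eb i ! k) (P i x) = inner (eb i ! k) x" if "k < length (eb i)" for i k x
    by (rule orth_proj_inner2[OF subE orthonormal_basis_props(3)[OF eb that]])
  have sumU: "(\<Sum>p\<in>J. d (fst p) * u (fst p) (snd p) * (inner (q p) x)\<^sup>2)
      = (\<Sum>j\<in>UNIV. d j * inner (U j (Q j x)) (Q j x))" for x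
    by (simp add: J_def sum_Sigma_lessThan q_def adjQ diagonal_quadratic_form[OF fb linU u(1) Q_in]
        sum_distrib_left power2_eq_square mult.assoc)
  have sumV: "(\<Sum>p\<in>I. c (fst p) * v (fst p) (snd p) * (inner (e p) x)\<^sup>2)
      = (\<Sum>i\<in>UNIV. c i * inner (V i (P i x)) (P i x))" for x
    by (simp add: I_def sum_Sigma_lessThan e_def diagonal_quadratic_form[OF eb linV v(1) P_in] eP
        sum_distrib_left power2_eq_square mult.assoc)
  have sum1: "(\<Sum>p\<in>J. d (fst p) * (inner (q p) x)\<^sup>2) = (\<Sum>j\<in>UNIV. d j * inner (Q j x) (Q j x))"
    "(\<Sum>p\<in>I. c (fst p) * (inner (e p) x)\<^sup>2) = (\<Sum>i\<in>UNIV. c i * inner (P i x) (P i x))" for x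
    by (simp_all add: I_def J_def sum_Sigma_lessThan e_def q_def adjQ
        orthonormal_basis_Parseval[OF fb Q_in] orthonormal_basis_Parseval[OF eb P_in] eP
        sum_distrib_left power2_eq_square)
  have pos: "0 < c (fst p)" "p \<in> I \<Longrightarrow> 0 < v (fst p) (snd p)" for p
    using cpos v(2) by (auto simp: I_def)
  have pos': "0 < d (fst p)" "p \<in> J \<Longrightarrow> 0 < u (fst p) (snd p)" for p
    using dpos u(2) by (auto simp: J_def)
  have "(\<Sum>p\<in>J. d (fst p) * ln (u (fst p) (snd p))) \<le> (\<Sum>p\<in>I. c (fst p) * ln (v (fst p) (snd p)))"
  proof (rule sum_powr_le_imp_sum_ln_le[OF pos'(2) pos(2)])
    \<comment> \<open>The dimension condition, read as equality of the two traces at exponent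
      0.\<close>
    show "(\<Sum>p\<in>J. d (fst p)) = (\<Sum>p\<in>I. c (fst p))"
      using dims orthonormal_basis_props(2)[OF eb] orthonormal_basis_props(2)[OF fb]
      by (simp add: I_def J_def sum_Sigma_lessThan mult.commute)
    fix n
    have "(\<Sum>p\<in>J. d (fst p) * u (fst p) (snd p) powr (1 / 2 ^ n) * (inner (q p) x)\<^sup>2)
        \<le> (\<Sum>p\<in>I. c (fst p) * v (fst p) (snd p) powr (1 / 2 ^ n) * (inner (e p) x)\<^sup>2)"
      if "x \<in> E0" for x
      by (rule interpolate_dyadic[OF fin subE0 eE0 ort expand pos pos' _ _ that])
        (use feas' id[unfolded gauss_feasible_iff] in \<open>simp_all add: sumU sumV sum1\<close>)
    from possemidef_trace_mono[OF subE0 T(1) eE0 qE0 this]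
    have "(\<Sum>p\<in>J. d (fst p) * u (fst p) (snd p) powr (1 / 2 ^ n) * inner (T (q p)) (q p))
        \<le> (\<Sum>p\<in>I. c (fst p) * v (fst p) (snd p) powr (1 / 2 ^ n) * inner (T (e p)) (e p))"
      by blast
    \<comment> \<open>The two conditions on the coupling normalise \<open>T\<close> at all
      \<open>q p\<close> and all \<open>e p\<close>; this removes \<open>T\<close> and leaves the
      traces of the powers.\<close>
    moreover have "inner (T (q p)) (q p) = 1" if "p \<in> J" for p
      using that QT[OF fbF[OF that]] orthonormal_basis_inner[OF fb, of "snd p" "fst p" "snd p"]
      by (auto simp: q_def adjQ J_def)
    moreover have "inner (T (e p)) (e p) = 1" if "p \<in> I" for p
      using T(2)[OF eE[OF that]] ort[OF that that] by simp
    ultimately show "(\<Sum>p\<in>J. d (fst p) * u (fst p) (snd p) powr (1 / 2 ^ n))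
        \<le> (\<Sum>p\<in>I. c (fst p) * v (fst p) (snd p) powr (1 / 2 ^ n))"
      by (simp cong: sum.cong)
  qed
  moreover have "ln (det_on (E i) (V i)) = (\<Sum>k<length (eb i). ln (v i k))" for i
    unfolding v(3) by (rule ln_prod) (use v(2)[of _ i] in \<open>auto simp: less_le\<close>)
  moreover have "ln (det_on (F j) (U j)) = (\<Sum>k<length (fb j). ln (u j k))" for j
    unfolding u(3) by (rule ln_prod) (use u(2)[of _ j] in \<open>auto simp: less_le\<close>)
  ultimately show ?thesis by (simp add: I_def J_def sum_Sigma_lessThan sum_distrib_left)
qed

text \<open>The identity pair is feasible with value 0, and no feasible pair has a positive
  value.\<close>

lemma geometric_imp_extremizable:
  assumes "geometric E F c d B" shows "gaussian_extremizable E F c d B"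
proof -
  let ?S = "gauss_values E F c d B"
  have "gauss_feasible E F c d B (\<lambda>i x. x) (\<lambda>j y. y)"
    using assms unfolding geometric_def gauss_feasible_id_iff by blast
  then have "0 \<in> ?S"
    unfolding gauss_values_def by (force simp: det_on_id)
  moreover have "x \<le> 0" if "x \<in> ?S" for x
    using that geometric_value_nonpos[OF assms] by (fastforce simp: gauss_values_def)
  ultimately show ?thesis
    unfolding gaussian_extremizable_def by (metis bdd_aboveI cSup_eq_maximum)
qed

end

section \<open>Change of variables\<close>

text \<open>\<open>U'\<close> is the congruence of \<open>U\<close> by \<open>M\<close>, compressed
  to \<open>S\<close> because the ambient adjoint of \<open>M\<close> may leave \<open>S\<close>.
  That the determinant of \<open>M\<close> is nonzero is read off from the determinant formula and
  the positivity of \<open>U'\<close>.\<close>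

lemma posdef_congruence:
  fixes M :: "'a::euclidean_space \<Rightarrow> 'a"
  assumes S: "subspace S" and U: "posdef_on S U"
    and M: "linear M" "M ` S \<subseteq> S" "inj_on M S"
  defines "U' \<equiv> \<lambda>x. orth_proj S (adjoint M (U (M x)))"
  shows "\<And>x y. y \<in> S \<Longrightarrow> inner (U' x) y = inner (U (M x)) (M y)"
    and "posdef_on S U'"
    and "det_on S U' = (det_on S M)\<^sup>2 * det_on S U"
    and "det_on S M \<noteq> 0"
proof -
  note sa = posdef_onD(1)[OF U]
  note lU = selfadjoint_onD(1)[OF sa]
  show form: "inner (U' x) y = inner (U (M x)) (M y)" if "y \<in> S" for x y
    using that by (simp add: U'_def orth_proj_inner[OF S] adjoint_clauses[OF M(1)])
  have lin: "linear U'"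
    unfolding U'_def
    using linear_compose[OF linear_compose[OF linear_compose[OF M(1) lU] adjoint_linear[OF M(1)]]
        orth_proj_linear[OF S]] by (simp add: o_def)
  have MS: "M x \<in> S" if "x \<in> S" for x using M(2) that by blast
  have M0: "M x \<noteq> 0" if "x \<in> S" "x \<noteq> 0" for x
    using M(3) that subspace_0[OF S] linear_0[OF M(1)] by (metis inj_onD)
  have "selfadjoint_on S U'"
    unfolding selfadjoint_on_def
  proof (intro conjI ballI lin)
    show "U' ` S \<subseteq> S" by (auto simp: U'_def orth_proj_in[OF S])
    show "inner (U' x) y = inner x (U' y)" if "x \<in> S" "y \<in> S" for x y
      using form that selfadjoint_onD(3)[OF sa MS MS, of x y] by (simp add: inner_commute)
  qed
  then show pd: "posdef_on S U'"
    unfolding posdef_on_def using form MS M0 posdef_onD(2)[OF U] by auto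
  have UM: "linear (\<lambda>x. U (M x))" "(\<lambda>x. U (M x)) ` S \<subseteq> S"
    using linear_compose[OF M(1) lU] selfadjoint_onD(2)[OF sa MS] by (auto simp: o_def)
  have PM: "linear (\<lambda>x. orth_proj S (adjoint M x))" "(\<lambda>x. orth_proj S (adjoint M x)) ` S \<subseteq> S"
    using linear_compose[OF adjoint_linear[OF M(1)] orth_proj_linear[OF S]] orth_proj_in[OF S]
    by (auto simp: o_def)
  have US: "U ` S \<subseteq> S" using selfadjoint_onD(2)[OF sa] by blast
  show det: "det_on S U' = (det_on S M)\<^sup>2 * det_on S U"
    unfolding U'_def
    using det_on_compose[OF S PM UM] det_on_compose[OF S lU US M(1,2)] det_on_adjoint[OF S M(1,2)]
    by (simp add: power2_eq_square)
  show "det_on S M \<noteq> 0" using det posdef_det_on_pos[OF S pd] by auto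
qed

text \<open>\<open>M\<close> and \<open>N\<close> are the powers of \<open>U\<close> with exponents
  -1/2 and 1/2, written in an eigenbasis of \<open>S\<close>. They vanish on the orthogonal
  complement of \<open>S\<close>, hence map the whole ambient space into \<open>S\<close>.\<close>

lemma posdef_inverse_sqrt:
  fixes U :: "'a::euclidean_space \<Rightarrow> 'a"
  assumes S: "subspace S" and U: "posdef_on S U"
  obtains M N where "linear M" "linear N" "\<And>x. M x \<in> S" "\<And>x. N x \<in> S"
    "\<And>x. x \<in> S \<Longrightarrow> M (N x) = x" "\<And>x. x \<in> S \<Longrightarrow> N (M x) = x"
    "\<And>x y. x \<in> S \<Longrightarrow> y \<in> S \<Longrightarrow> inner (U (M x)) (M y) = inner x y"
proof -
  obtain bs l where bs: "orthonormal_basis S bs"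
    and diag: "\<And>k. k < length bs \<Longrightarrow> U (bs ! k) = l k *\<^sub>R bs ! k"
    and l: "\<And>k. k < length bs \<Longrightarrow> 0 < l k"
    by (rule posdef_diagonalizable[OF S U]) blast
  define D where "D a x = (\<Sum>k<length bs. (a k * inner (bs ! k) x) *\<^sub>R bs ! k)" for a :: "nat \<Rightarrow> real" and x
  have D: "linear (D a)" "D a x \<in> S" for a x
    using S orthonormal_basis_props(3)[OF bs]
    by (auto intro!: linearI subspace_sum subspace_scale
        simp: D_def inner_add_right algebra_simps sum.distrib scaleR_sum_right)
  have coeff: "inner (bs ! k) (D a x) = a k * inner (bs ! k) x" if "k < length bs" for a k x
    unfolding D_def by (rule orthonormal_basis_inner_sum[OF bs that])
  have inv: "D a (D b x) = x" if "x \<in> S" "\<And>k. k < length bs \<Longrightarrow> a k * b k = 1" for a b x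
    by (subst D_def, subst (2) orthonormal_basis_props(4)[OF bs that(1)])
      (simp add: coeff that(2) flip: mult.assoc)
  define r where "r k = sqrt (l k)" for k
  have r: "r k \<noteq> 0" "r k * r k = l k" "l k \<noteq> 0" if "k < length bs" for k
    using l[OF that] by (auto simp: r_def)
  show thesis
  proof (rule that[of "D (\<lambda>k. 1 / r k)" "D r"])
    have "inner (U (D (\<lambda>k. 1 / r k) x)) (D (\<lambda>k. 1 / r k) y) = inner x y" if "x \<in> S" "y \<in> S" for x y
    proof -
      have "inner (U (D a x)) (D a y) =
          (\<Sum>k<length bs. l k * (inner (bs ! k) (D a x) * inner (bs ! k) (D a y)))" for a
        by (rule diagonal_quadratic_form[OF bs selfadjoint_onD(1)[OF posdef_onD(1)[OF U]] diag D(2)])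
      then show ?thesis
        unfolding orthonormal_basis_Parseval[OF bs that(1)]
        using r by (auto intro!: sum.cong simp: coeff field_simps)
    qed
    then show "inner (U (D (\<lambda>k. 1 / r k) x)) (D (\<lambda>k. 1 / r k) y) = inner x y"
      if "x \<in> S" "y \<in> S" for x y using that .
  qed (use D inv r in auto)
qed

lemma ln_square_mult:
  fixes m u :: real
  assumes "m \<noteq> 0" "0 < u" shows "ln (m\<^sup>2 * u) = 2 * ln \<bar>m\<bar> + ln u"
proof -
  have "ln (\<bar>m\<bar> ^ 2) = 2 * ln \<bar>m\<bar>" using ln_realpow[of "\<bar>m\<bar>" 2] assms(1) by simp
  then show ?thesis using assms by (simp add: ln_mult_pos)
qed

definition gauss_value where
  "gauss_value E F c d V U =
    1/2 * ((\<Sum>j\<in>UNIV. d j * ln (det_on (F j) (U j))) - (\<Sum>i\<in>UNIV. c i * ln (det_on (E i) (V i))))"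

lemma gauss_values_eq:
  "gauss_values E F c d B = {gauss_value E F c d V U | V U. gauss_feasible E F c d B V U}"
  by (simp add: gauss_values_def gauss_value_def)

text \<open>The change of the objective under pullback. A congruence multiplies a determinant by a
  square, and this exponent 2 cancels the factor 1/2 of the objective.\<close>

definition value_shift where
  "value_shift E F c d C M =
    (\<Sum>j\<in>UNIV. d j * ln \<bar>det_on (F j) (M j)\<bar>) - (\<Sum>i\<in>UNIV. c i * ln \<bar>det_on (E i) C\<bar>)"

text \<open>A morphism of data from \<open>B'\<close> to \<open>B\<close>; an equivalence amounts to a pair of mutually inverse ones.\<close>

locale datum_morphism = datum E F c d B + B': datum E F c d B'
  for E :: "'k::finite \<Rightarrow> 'a::euclidean_space set" and F :: "'m::finite \<Rightarrow> 'b::euclidean_space set"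
    and c d B B' +
  fixes C :: "'a \<Rightarrow> 'a" and M :: "'m \<Rightarrow> 'b \<Rightarrow> 'b"
  assumes linC: "linear C" and C_in: "x \<in> E i \<Longrightarrow> C x \<in> E i" and inj_C: "inj_on C E0"
    and linM: "linear (M j)" and M_in: "y \<in> F j \<Longrightarrow> M j y \<in> F j" and inj_M: "inj_on (M j) (F j)"
    and intertwine: "x \<in> E0 \<Longrightarrow> M j (total_map E B' j x) = total_map E B j (C x)"
begin

text \<open>This is where it counts that \<open>C\<close> respects the summands; a \<open>C\<close>
  mixing them would destroy the block form of the constraint.\<close>

lemma P_C: assumes "x \<in> E0" shows "P i (C x) = C (P i x)"
proof -
  have "C x = (\<Sum>i\<in>UNIV. C (P i x))"
    using E0_sum[OF assms] linear_sum[OF linC, of "\<lambda>i. P i x" UNIV] by simp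
  then show ?thesis by (simp add: P_sum C_in)
qed

lemma M_Q: assumes "x \<in> E0" shows "M j (B'.Q j x) = Q j (C x)"
proof -
  \<comment> \<open>\<open>Lambda\<close> is a scalar on each summand and hence commutes with a
    block-diagonal map.\<close>
  have "C (Lambda E c x) = Lambda E c (C x)"
    by (simp add: Lambda_eq linear_sum[OF linC] linear_scale[OF linC] P_C[OF assms])
  then show ?thesis by (simp add: Q_map_def intertwine[OF Lambda_in])
qed

abbreviation "pull_V V \<equiv> \<lambda>i x. P i (adjoint C (V i (C x)))"
abbreviation "pull_U U \<equiv> \<lambda>j y. orth_proj (F j) (adjoint (M j) (U j (M j y)))"

lemma inj_C_E: "inj_on C (E i)"
  using inj_C by (rule inj_on_subset) (use E_E0 in blast)

lemma C_img: "C ` E i \<subseteq> E i" using C_in by blast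

lemma M_img: "M j ` F j \<subseteq> F j" using M_in by blast

lemmas pull_V_props = posdef_congruence[OF subE _ linC C_img inj_C_E]
lemmas pull_U_props = posdef_congruence[OF subF _ linM M_img inj_M]

text \<open>Evaluating the constraint for \<open>B\<close> at \<open>C z\<close> gives the
  constraint for \<open>B'\<close> at \<open>z\<close>, since \<open>M\<close> and \<open>C\<close>
  intertwine the maps \<open>Q\<close> and \<open>C\<close> commutes with the projections.\<close>

lemma pull_feasible:
  assumes feas: "gauss_feasible E F c d B V U"
  shows "gauss_feasible E F c d B' (pull_V V) (pull_U U)"
    and "gauss_value E F c d (pull_V V) (pull_U U) = gauss_value E F c d V U + value_shift E F c d C M"
proof -
  note feas' = feas[unfolded gauss_feasible_iff]
  have V: "posdef_on (E i) (V i)" and U: "posdef_on (F j) (U j)" for i j using feas' by blast+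
  have "(\<Sum>j\<in>UNIV. d j * inner (pull_U U j (B'.Q j x)) (B'.Q j x))
      \<le> (\<Sum>i\<in>UNIV. c i * inner (pull_V V i (P i x)) (P i x))" for x
  proof -
    \<comment> \<open>The intertwining relations hold on \<open>E0\<close>, whereas the feasibility
      criterion ranges over the ambient space.\<close>
    define z where "z = orth_proj E0 x"
    have z: "z \<in> E0" "B'.Q j x = B'.Q j z" "P i x = P i z" for i j
      by (auto simp: z_def orth_proj_in B'.Q_orth_proj_E0 P_orth_proj_E0)
    have "inner (pull_U U j (B'.Q j z)) (B'.Q j z) = inner (U j (Q j (C z))) (Q j (C z))" for j
      by (subst pull_U_props(1)[OF U B'.Q_in]) (simp add: M_Q[OF z(1)])
    moreover have "inner (pull_V V i (P i z)) (P i z) = inner (V i (P i (C z))) (P i (C z))" for i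
      by (subst pull_V_props(1)[OF V P_in]) (simp add: P_C[OF z(1)])
    ultimately show ?thesis using feas' unfolding z(2,3) by simp
  qed
  then show "gauss_feasible E F c d B' (pull_V V) (pull_U U)"
    unfolding B'.gauss_feasible_iff using pull_U_props(2)[OF U] pull_V_props(2)[OF V] by blast
  have lnU: "ln (det_on (F j) (pull_U U j)) = 2 * ln \<bar>det_on (F j) (M j)\<bar> + ln (det_on (F j) (U j))" for j
    unfolding pull_U_props(3)[OF U]
    by (rule ln_square_mult[OF pull_U_props(4)[OF U] posdef_det_on_pos[OF subF U]])
  have lnV: "ln (det_on (E i) (pull_V V i)) = 2 * ln \<bar>det_on (E i) C\<bar> + ln (det_on (E i) (V i))" for i
    unfolding pull_V_props(3)[OF V]
    by (rule ln_square_mult[OF pull_V_props(4)[OF V] posdef_det_on_pos[OF subE V]])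
  show "gauss_value E F c d (pull_V V) (pull_U U) = gauss_value E F c d V U + value_shift E F c d C M"
    by (simp add: gauss_value_def value_shift_def lnU lnV distrib_left sum.distrib
        mult.left_commute[of _ 2] flip: sum_distrib_left)
qed

lemma gauss_values_shift:
  assumes "w \<in> gauss_values E F c d B"
  shows "w + value_shift E F c d C M \<in> gauss_values E F c d B'"
proof -
  obtain V U where "w = gauss_value E F c d V U" "gauss_feasible E F c d B V U"
    using assms unfolding gauss_values_eq by blast
  then show ?thesis
    unfolding gauss_values_eq using pull_feasible[of V U] by force
qed

end

section \<open>Isomorphic data have translated value sets\<close>

lemma det_on_inverse:
  assumes S: "subspace S" and "linear M" "\<And>x. x \<in> S \<Longrightarrow> M x \<in> S" "linear N" "\<And>x. x \<in> S \<Longrightarrow> N x \<in> S"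
    and MN: "\<And>x. x \<in> S \<Longrightarrow> M (N x) = x"
  shows "ln \<bar>det_on S M\<bar> + ln \<bar>det_on S N\<bar> = 0"
proof -
  have "det_on S M * det_on S N = det_on S (\<lambda>x. M (N x))"
    using assms by (intro det_on_compose[symmetric]) auto
  also have "\<dots> = 1" using det_on_cong[OF S MN] det_on_id[OF S] by simp
  finally have "\<bar>det_on S M\<bar> * \<bar>det_on S N\<bar> = 1" by (simp flip: abs_mult)
  then show ?thesis
    by (metis abs_ge_zero abs_zero ln_mult ln_one mult_zero_left mult_zero_right zero_neq_one less_le)
qed

locale datum_isomorphism = datum_morphism E F c d B B' C M + inv: datum_morphism E F c d B' B C' M'
  for E :: "'k::finite \<Rightarrow> 'a::euclidean_space set" and F :: "'m::finite \<Rightarrow> 'b::euclidean_space set"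
    and c d B B' C M C' M' +
  assumes CC': "x \<in> direct_sum E \<Longrightarrow> C (C' x) = x"
    and MM': "y \<in> F j \<Longrightarrow> M j (M' j y) = y"
begin

lemma value_shift_inverse: "value_shift E F c d C M + value_shift E F c d C' M' = 0"
proof -
  have 1: "ln \<bar>det_on (F j) (M j)\<bar> + ln \<bar>det_on (F j) (M' j)\<bar> = 0" for j
    by (rule det_on_inverse[OF subF linM M_in inv.linM inv.M_in MM'])
  have 2: "ln \<bar>det_on (E i) C\<bar> + ln \<bar>det_on (E i) C'\<bar> = 0" for i
    by (rule det_on_inverse[OF subE linC C_in inv.linC inv.C_in CC'[OF E_E0]])
  have "value_shift E F c d C M + value_shift E F c d C' M' =
      (\<Sum>j\<in>UNIV. d j * (ln \<bar>det_on (F j) (M j)\<bar> + ln \<bar>det_on (F j) (M' j)\<bar>))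
      - (\<Sum>i\<in>UNIV. c i * (ln \<bar>det_on (E i) C\<bar> + ln \<bar>det_on (E i) C'\<bar>))"
    by (simp add: value_shift_def distrib_left sum.distrib)
  then show ?thesis by (simp add: 1 2)
qed

text \<open>The two pullbacks translate the sets of values by opposite amounts, so these sets are
  translates of each other and an attained supremum carries over.\<close>

lemma extremizable_imp:
  assumes "gaussian_extremizable E F c d B'"
  shows "gaussian_extremizable E F c d B"
proof -
  let ?s = "value_shift E F c d C M" and ?S = "Sup (gauss_values E F c d B')"
  have bdd: "bdd_above (gauss_values E F c d B')" and at: "?S \<in> gauss_values E F c d B'"
    using assms by (auto simp: gaussian_extremizable_def)
  have "?S - ?s \<in> gauss_values E F c d B"
    using inv.gauss_values_shift[OF at] value_shift_inverse
    by (metis add_diff_cancel_left' add_uminus_conv_diff diff_0)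
  moreover have "w \<le> ?S - ?s" if "w \<in> gauss_values E F c d B" for w
    using cSup_upper[OF gauss_values_shift[OF that] bdd] by simp
  ultimately show ?thesis
    unfolding gaussian_extremizable_def by (metis bdd_aboveI cSup_eq_maximum)
qed

end

context datum
begin

text \<open>\<open>inv_into\<close> is controlled on the subspace only and need not be linear on the
  ambient type. It is replaced by linear left inverses, which agree with it on the subspace.\<close>

lemma equivalent_data_isomorphism:
  assumes B': "is_datum E F c d B'" and eq: "equivalent_data E F c d B c d B'"
  obtains C M C' M' where "datum_isomorphism E F c d B B' C M C' M'"
proof -
  interpret B': datum E F c d B' by (rule datum.intro[OF B'])
  obtain C D where C: "invertible_on E0 C" "\<And>i. C ` E i \<subseteq> E i"
    and D: "\<And>j. invertible_on (F j) (D j)"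
    and rel: "\<And>j x. x \<in> E0 \<Longrightarrow>
      total_map E B' j x = inv_into (F j) (D j) (total_map E B j (inv_into E0 C x))"
    using eq unfolding equivalent_data_def by blast
  have lC: "linear C" and bC: "bij_betw C E0 E0" using C(1) by (auto simp: invertible_on_def)
  have lD: "linear (D j)" and bD: "bij_betw (D j) (F j) (F j)" for j
    using D by (auto simp: invertible_on_def)
  have inverse: "\<exists>g. linear g \<and> (\<forall>x\<in>S. g (f x) = x)"
    if "linear f" "bij_betw f S S" "subspace S" for f :: "'z::euclidean_space \<Rightarrow> 'z" and S
    using linear_inj_on_left_inverse[OF that(1), of S] that(2) by (auto simp: bij_betw_def span_eq_iff[THEN iffD2, OF that(3)])
  obtain C' where C': "linear C'" "\<And>x. x \<in> E0 \<Longrightarrow> C' (C x) = x"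
    using inverse[OF lC bC subE0] by blast
  obtain D' where D': "\<And>j. linear (D' j)" "\<And>j y. y \<in> F j \<Longrightarrow> D' j (D j y) = y"
    using inverse[OF lD bD subF] by metis
  have inv_facts: "g x = inv_into S f x" "g x \<in> S" "f (g x) = x"
    if bij: "bij_betw f S S" and g: "\<And>x. x \<in> S \<Longrightarrow> g (f x) = x" and x: "x \<in> S" for f g :: "'z \<Rightarrow> 'z" and S x
  proof -
    obtain y where y: "y \<in> S" "x = f y" using bij x unfolding bij_betw_def by (metis imageE)
    show "g x = inv_into S f x" "g x \<in> S" "f (g x) = x"
      using bij g y by (auto simp: bij_betw_def)
  qed
  have C'f: "C' x = inv_into E0 C x" "C' x \<in> E0" "C (C' x) = x" if "x \<in> E0" for x
    using inv_facts[OF bC C'(2) that] by auto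
  have D'f: "D' j y = inv_into (F j) (D j) y" "D' j y \<in> F j" "D j (D' j y) = y" if "y \<in> F j" for j y
    using inv_facts[OF bD D'(2) that] by auto
  have rel1: "total_map E B' j x = D' j (total_map E B j (C' x))" if "x \<in> E0" for j x
    using rel[OF that] C'f[OF that] D'f[OF total_in] by simp
  \<comment> \<open>Equivalence provides only an inclusion; injectivity and a dimension count make
    it an equality, so that the inverse of \<open>C\<close> preserves the summands too.\<close>
  have CE: "C ` E i = E i" for i
  proof -
    have "inj_on C (E i)" using bC E_E0 by (auto simp: bij_betw_def inj_on_def)
    then have "dim (C ` E i) = dim (E i)"
      using lC by (intro dim_image_eq) (auto simp: span_eq_iff[THEN iffD2, OF subE])
    then show ?thesis
      using C(2)[of i] lC by (intro subspace_dim_equal) (auto simp: linear_subspace_image)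
  qed
  have C'E: "C' x \<in> E i" if x: "x \<in> E i" for i x
  proof -
    obtain y where "y \<in> E i" "x = C y" using x CE[of i] by blast
    then show ?thesis using C'(2)[OF E_E0] by auto
  qed
  show thesis
  \<comment> \<open>The relation B' = D^-1 B C^-1 reads D B' = B C^-1, so the morphism from
    \<open>B'\<close> to \<open>B\<close> consists of the inverse of \<open>C\<close> and of
    \<open>D\<close> itself.\<close>
  proof (rule that[of C' D C D'], intro datum_isomorphism.intro datum_morphism.intro
      datum_isomorphism_axioms.intro datum_morphism_axioms.intro datum.intro datum B')
    show "D j (total_map E B' j x) = total_map E B j (C' x)" if "x \<in> E0" for j x
      using rel1[OF that] D'f(3)[OF total_in] by simp
    show "D' j (total_map E B j x) = total_map E B' j (C x)" if "x \<in> E0" for j x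
      using rel1[of "C x" j] that bij_betwE[OF bC] C'(2) by auto
    show "inj_on C' E0" by (rule inj_on_inverseI[where g = C]) (rule C'f(3))
    show "inj_on (D' j) (F j)" for j by (rule inj_on_inverseI[where g = "D j"]) (rule D'f(3))
    show "inj_on C E0" "inj_on (D j) (F j)" for j using bC bD by (auto simp: bij_betw_def)
    show "D j y \<in> F j" if "y \<in> F j" for j y using bD[of j] that by (auto simp: bij_betw_def)
  qed (use C(2) C' D' lC lD C'E D'f(2,3) in \<open>auto simp: image_subset_iff\<close>)
qed

end

section \<open>Couplings by separation\<close>

text \<open>At a minimiser \<open>z\<close> of the squared distance to the target, the residual
  \<open>r\<close> forms an angle of at most 90 degrees with every direction into the convex set. If
  the residual is nonzero, it is the separating functional, and the minimum itself is the gap. Only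
  the finitely many functionals enter, so no inner product on the space of \<open>K\<close> is
  required.\<close>

lemma residual_separation:
  fixes K :: "'v::real_normed_vector set" and \<phi> :: "'l \<Rightarrow> 'v \<Rightarrow> real"
  assumes K: "compact K" "convex K" "K \<noteq> {}"
    and lin: "\<And>l. l \<in> L \<Longrightarrow> linear (\<phi> l)" and cont: "\<And>l. l \<in> L \<Longrightarrow> continuous_on K (\<phi> l)"
    and L: "finite L"
  obtains (solution) x where "x \<in> K" "\<And>l. l \<in> L \<Longrightarrow> \<phi> l x = t l"
    | (separation) r \<rho> where "0 < \<rho>"
      "\<And>x. x \<in> K \<Longrightarrow> (\<Sum>l\<in>L. r l * t l) + \<rho> \<le> (\<Sum>l\<in>L. r l * \<phi> l x)"
proof -
  define f where "f x = (\<Sum>l\<in>L. (\<phi> l x - t l)\<^sup>2)" for x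
  have "continuous_on K f" unfolding f_def by (intro continuous_intros cont)
  then obtain z where z: "z \<in> K" "\<And>x. x \<in> K \<Longrightarrow> f z \<le> f x"
    using continuous_attains_inf[OF K(1,3)] by blast
  define r where "r l = \<phi> l z - t l" for l
  have fz: "f z = (\<Sum>l\<in>L. r l * r l)" by (simp add: f_def r_def power2_eq_square)
  show thesis
  proof (cases "f z = 0")
    case True
    then have "\<forall>l\<in>L. r l * r l = 0" unfolding fz using L by (subst (asm) sum_nonneg_eq_0_iff) auto
    then show thesis by (intro solution[OF z(1)]) (auto simp: r_def)
  next
    case False
    moreover have "0 \<le> f z" unfolding f_def by (intro sum_nonneg) auto
    ultimately have "0 < f z" by simp
    moreover have "(\<Sum>l\<in>L. r l * t l) + f z \<le> (\<Sum>l\<in>L. r l * \<phi> l x)" if x: "x \<in> K" for x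
    proof -
      define a where "a = (\<Sum>l\<in>L. r l * (\<phi> l x - \<phi> l z))"
      define g where "g = (\<Sum>l\<in>L. (\<phi> l x - \<phi> l z)\<^sup>2)"
      \<comment> \<open>Moving from \<open>z\<close> towards \<open>x\<close> stays in the convex
        set and cannot decrease \<open>f\<close>. This is available for \<open>s\<close> between 0
        and 1 only, hence yields only the sign of \<open>a\<close>.\<close>
      have step: "0 \<le> 2 * s * a + s\<^sup>2 * g" if s: "0 \<le> s" "s \<le> 1" for s
      proof -
        define y where "y = (1 - s) *\<^sub>R z + s *\<^sub>R x"
        have "y \<in> K" unfolding y_def using K(2) z(1) x s by (intro convexD) auto
        have "\<phi> l y - t l = r l + s * (\<phi> l x - \<phi> l z)" if "l \<in> L" for l
        proof -
          have "\<phi> l y = (1 - s) * \<phi> l z + s * \<phi> l x"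
            unfolding y_def by (simp add: linear_add[OF lin[OF that]] linear_scale[OF lin[OF that]])
          then show ?thesis by (simp add: r_def algebra_simps)
        qed
        then have "f y = (\<Sum>l\<in>L. (r l + s * (\<phi> l x - \<phi> l z))\<^sup>2)" by (simp add: f_def)
        also have "\<dots> = f z + (2 * s * a + s\<^sup>2 * g)"
          unfolding fz a_def g_def sum_distrib_left sum.distrib[symmetric]
          by (intro sum.cong) (auto simp: power2_eq_square algebra_simps)
        finally show ?thesis using z(2)[OF \<open>y \<in> K\<close>] by simp
      qed
      have "0 \<le> a"
      proof (rule ccontr)
        assume "\<not> 0 \<le> a"
        then have a: "a < 0" by simp
        \<comment> \<open>This places the minimum \<open>- a / g\<close> of the parabola inside the
          admissible interval.\<close>
        then have g: "- 2 * a \<le> g" using step[of 1] by simp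
        then have "0 < g" using a by simp
        have "2 * (- a / g) * a + (- a / g)\<^sup>2 * g = - (a\<^sup>2 / g)"
          using \<open>0 < g\<close> by (simp add: power2_eq_square field_simps)
        also have "\<dots> < 0" using a \<open>0 < g\<close> by simp
        finally have "2 * (- a / g) * a + (- a / g)\<^sup>2 * g < 0" .
        moreover have "0 \<le> - a / g" "- a / g \<le> 1"
          using a g \<open>0 < g\<close> by (simp_all add: divide_simps)
        ultimately show False using step[of "- a / g"] by linarith
      qed
      moreover have "(\<Sum>l\<in>L. r l * \<phi> l x) = a + ((\<Sum>l\<in>L. r l * t l) + f z)"
        unfolding a_def fz sum.distrib[symmetric]
        by (intro sum.cong) (auto simp: r_def algebra_simps)
      ultimately show ?thesis by simp
    qed
    ultimately show thesis by (rule separation)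
  qed
qed

text \<open>Operators on the whole space are used here because \<open>'a \<Rightarrow>\<^sub>L 'a\<close> has the Heine-Borel property.\<close>

definition trace_psd_set ::
  "'a::euclidean_space set \<Rightarrow> 'p set \<Rightarrow> ('p \<Rightarrow> 'a) \<Rightarrow> real \<Rightarrow> ('a \<Rightarrow>\<^sub>L 'a) set" where
  "trace_psd_set S I e n = {T :: 'a \<Rightarrow>\<^sub>L 'a. (\<forall>x y. inner (T x) y = inner x (T y)) \<and> (\<forall>x. 0 \<le> inner (T x) x) \<and>
     (\<forall>x. T (orth_proj S x) = T x) \<and> (\<Sum>p\<in>I. inner (T (e p)) (e p)) = n}"

lemma trace_psd_setD:
  assumes "T \<in> trace_psd_set S I e n"
  shows "inner (T x) y = inner x (T y)" "0 \<le> inner (T x) x" "T (orth_proj S x) = T x"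
    "(\<Sum>p\<in>I. inner (T (e p)) (e p)) = n"
  using assms unfolding trace_psd_set_def by blast+

lemma trace_psd_set_closed: "closed (trace_psd_set S I e n)"
  unfolding trace_psd_set_def
  by (intro closed_Collect_conj closed_Collect_all closed_Collect_eq closed_Collect_le continuous_intros)

lemma trace_psd_set_convex: "convex (trace_psd_set (S :: 'a::euclidean_space set) I e n)"
proof (rule convexI)
  fix T U :: "'a \<Rightarrow>\<^sub>L 'a" and u v :: real
  assume TU: "T \<in> trace_psd_set S I e n" "U \<in> trace_psd_set S I e n" and uv: "0 \<le> u" "0 \<le> v" "u + v = 1"
  have "(\<Sum>p\<in>I. u * inner (T (e p)) (e p) + v * inner (U (e p)) (e p)) = u * n + v * n"
    using TU[THEN trace_psd_setD(4)] by (simp add: sum.distrib flip: sum_distrib_left)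
  also have "\<dots> = n" using uv(3) by (simp flip: distrib_right)
  finally show "u *\<^sub>R T + v *\<^sub>R U \<in> trace_psd_set S I e n"
    using trace_psd_setD[OF TU(1)] trace_psd_setD[OF TU(2)] uv
    by (simp add: trace_psd_set_def blinfun.add_left blinfun.scaleR_left inner_add_left inner_add_right)
qed

text \<open>By selfadjointness, invariance of \<open>T\<close> under projecting its argument becomes
  invariance under projecting its value.\<close>

lemma trace_psd_set_range:
  assumes S: "subspace S" and T: "T \<in> trace_psd_set S I e n"
  shows "blinfun_apply T x \<in> S"
proof -
  have "inner (orth_proj S (T x)) y = inner (T x) y" for y
    using T by (simp add: orth_proj_selfadjoint[OF S] trace_psd_set_def)
  then have "orth_proj S (T x) = T x" by (metis inner_commute vector_eq_rdot)
  then show ?thesis by (metis orth_proj_in[OF S])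
qed

lemma trace_psd_set_selfadjoint:
  assumes S: "subspace S" and T: "T \<in> trace_psd_set S I e n"
  shows "selfadjoint_on S (blinfun_apply T)"
  unfolding selfadjoint_on_def
  using T trace_psd_set_range[OF S T] blinfun.bounded_linear_right[of T]
  by (auto simp: trace_psd_set_def intro: bounded_linear.linear)

text \<open>The eigenvalues on \<open>S\<close> are nonnegative, and the Parseval identity for
  \<open>e\<close> shows that their sum is the trace \<open>n\<close>. This bound gives
  compactness.\<close>

lemma trace_psd_set_bound:
  fixes S :: "'a::euclidean_space set"
  assumes S: "subspace S" and T: "T \<in> trace_psd_set S I e n"
    and e: "\<And>p. p \<in> I \<Longrightarrow> e p \<in> S" "\<And>x. x \<in> S \<Longrightarrow> (\<Sum>p\<in>I. (inner (e p) x)\<^sup>2) = inner x x"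
  shows "norm T \<le> n"
proof -
  note sa = trace_psd_set_selfadjoint[OF S T]
  note lin = selfadjoint_onD(1)[OF sa]
  obtain bs l where bs: "orthonormal_basis S bs"
    and diag: "\<And>k. k < length bs \<Longrightarrow> T (bs ! k) = l k *\<^sub>R bs ! k"
    by (rule selfadjoint_diagonalizable[OF S sa]) blast
  have bsS: "bs ! k \<in> S" and one: "inner (bs ! k) (bs ! k) = 1" if "k < length bs" for k
    using orthonormal_basis_props(3)[OF bs that] orthonormal_basis_inner[OF bs that that] by auto
  have l: "0 \<le> l k" if "k < length bs" for k
  proof -
    have "0 \<le> inner (T (bs ! k)) (bs ! k)" using T by (rule trace_psd_setD(2))
    then show ?thesis using diag[OF that] one[OF that] by simp
  qed
  have form: "inner (T x) x = (\<Sum>k<length bs. l k * (inner x (bs ! k))\<^sup>2)" if "x \<in> S" for x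
    using diagonal_quadratic_form[OF bs lin diag that, of x]
    by (simp add: power2_eq_square inner_commute)
  have "n = (\<Sum>p\<in>I. 1 * inner (T (e p)) (e p))" using trace_psd_setD(4)[OF T] by simp
  also have "\<dots> = (\<Sum>k<length bs. l k * (\<Sum>p\<in>I. 1 * (inner (e p) (bs ! k))\<^sup>2))"
    by (rule weighted_sum_swap) (rule form[OF e(1)])
  finally have n: "n = (\<Sum>k<length bs. l k)" by (simp add: e(2) bsS one)
  show ?thesis
  proof (rule norm_blinfun_bound)
    show "0 \<le> n" unfolding n using l by (auto intro: sum_nonneg)
    fix x
    have "T x = T (\<Sum>k<length bs. inner (bs ! k) x *\<^sub>R bs ! k)"
      using T by (simp add: trace_psd_set_def flip: orth_proj_basis[OF bs])
    also have "\<dots> = (\<Sum>k<length bs. inner (bs ! k) x *\<^sub>R l k *\<^sub>R bs ! k)"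
      by (simp add: linear_sum[OF lin] linear_scale[OF lin] diag)
    finally have "norm (T x) \<le> (\<Sum>k<length bs. norm (inner (bs ! k) x *\<^sub>R l k *\<^sub>R bs ! k))"
      by (simp only: norm_sum)
    also have "\<dots> \<le> (\<Sum>k<length bs. l k * norm x)"
    proof (rule sum_mono)
      fix k assume "k \<in> {..<length bs}"
      then have k: "k < length bs" by simp
      have "norm (bs ! k) = 1" using one[OF k] by (simp add: norm_eq_1)
      then have "\<bar>inner (bs ! k) x\<bar> \<le> norm x" using Cauchy_Schwarz_ineq2[of "bs ! k" x] by simp
      then show "norm (inner (bs ! k) x *\<^sub>R l k *\<^sub>R bs ! k) \<le> l k * norm x"
        using l[OF k] \<open>norm (bs ! k) = 1\<close> mult_right_mono[of "\<bar>inner (bs ! k) x\<bar>" "norm x" "l k"]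
        by (simp add: abs_mult mult.commute)
    qed
    finally show "norm (T x) \<le> n * norm x" by (simp add: n sum_distrib_right)
  qed
qed

text \<open>These are the elements on which a separating functional is tested; the factor
  \<open>n / inner x x\<close> gives the rank-one operator the trace \<open>n\<close>.\<close>

lemma trace_psd_set_rank_one:
  fixes S :: "'a::euclidean_space set"
  assumes S: "subspace S" and x: "x \<in> S" "x \<noteq> 0" and n: "0 \<le> n"
    and e: "\<And>x. x \<in> S \<Longrightarrow> (\<Sum>p\<in>I. (inner (e p) x)\<^sup>2) = inner x x"
  obtains T where "T \<in> trace_psd_set S I e n"
    "\<And>y. blinfun_apply T y = (n / inner x x * inner x y) *\<^sub>R x"
proof
  let ?f = "\<lambda>y. (n / inner x x * inner x y) *\<^sub>R x"
  have "linear ?f" by (auto intro!: linearI simp: inner_add_right distrib_left add_divide_distrib scaleR_left_distrib)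
  then have app: "blinfun_apply (Blinfun ?f) = ?f"
    by (intro bounded_linear_Blinfun_apply) (simp add: linear_conv_bounded_linear)
  show "blinfun_apply (Blinfun ?f) y = ?f y" for y unfolding app ..
  have form: "inner (?f y) z = n / inner x x * inner x y * inner x z" for y z by simp
  have "(\<Sum>p\<in>I. inner (?f (e p)) (e p)) = n / inner x x * (\<Sum>p\<in>I. (inner (e p) x)\<^sup>2)"
    unfolding form by (simp add: sum_distrib_left power2_eq_square inner_commute mult.assoc)
  also have "\<dots> = n" using e[OF x(1)] x(2) by simp
  finally have tr: "(\<Sum>p\<in>I. inner (?f (e p)) (e p)) = n" .
  show "Blinfun ?f \<in> trace_psd_set S I e n"
    unfolding trace_psd_set_def mem_Collect_eq app
  proof (intro conjI allI tr)
    show "inner (?f y) z = inner y (?f z)" for y z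
      unfolding inner_commute[of y] form by simp
    show "0 \<le> inner (?f y) y" for y unfolding form using n
      by (simp add: mult.assoc zero_le_mult_iff)
    show "?f (orth_proj S y) = ?f y" for y by (simp add: orth_proj_inner2[OF S x(1)])
  qed
qed

section \<open>Operators given by coefficients in an orthonormal basis\<close>

lemma posdef_diagonalI:
  assumes sa: "selfadjoint_on S f" and bs: "orthonormal_basis S bs"
    and diag: "\<And>k. k < length bs \<Longrightarrow> f (bs ! k) = l k *\<^sub>R bs ! k"
    and l: "\<And>k. k < length bs \<Longrightarrow> 0 < l k"
  shows "posdef_on S f"
  unfolding posdef_on_def
proof (intro conjI ballI impI sa)
  fix x assume x: "x \<in> S" "x \<noteq> 0"
  have "\<exists>k<length bs. inner (bs ! k) x \<noteq> 0"
  proof (rule ccontr)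
    assume "\<not> ?thesis"
    then have "x = 0" by (subst orthonormal_basis_props(4)[OF bs x(1)]) simp
    with x show False by simp
  qed
  then obtain k where k: "k < length bs" "inner (bs ! k) x \<noteq> 0" by blast
  have "0 < (\<Sum>k<length bs. l k * (inner (bs ! k) x * inner (bs ! k) x))"
    by (rule sum_pos2[of _ k]) (use k l in \<open>auto simp: less_imp_le zero_less_mult_iff linorder_neq_iff\<close>)
  then show "0 < inner (f x) x"
    using diagonal_quadratic_form[OF bs selfadjoint_onD(1)[OF sa] diag x(1), of x] by simp
qed

text \<open>The coefficients of a separating functional form a matrix that need not be symmetric.
  This is the operator of its symmetrisation, which has the same quadratic form and the same
  trace.\<close>

definition sym_op :: "'a::euclidean_space list \<Rightarrow> (nat \<Rightarrow> nat \<Rightarrow> real) \<Rightarrow> 'a \<Rightarrow> 'a" where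
  "sym_op bs a x = (\<Sum>k<length bs. \<Sum>l<length bs.
     (a k l / 2) *\<^sub>R (inner (bs ! l) x *\<^sub>R bs ! k + inner (bs ! k) x *\<^sub>R bs ! l))"

lemma sym_op_form:
  "inner (sym_op bs a x) y = (\<Sum>k<length bs. \<Sum>l<length bs.
     a k l / 2 * (inner (bs ! l) x * inner (bs ! k) y + inner (bs ! k) x * inner (bs ! l) y))"
  by (simp add: sym_op_def inner_sum_left inner_add_left)

lemma sym_op_quadratic_form:
  "inner (sym_op bs a x) x = (\<Sum>k<length bs. \<Sum>l<length bs. a k l * (inner (bs ! k) x * inner (bs ! l) x))"
  unfolding sym_op_form by (intro sum.cong) (auto simp: algebra_simps)

lemma sym_op_selfadjoint:
  assumes bs: "orthonormal_basis S bs"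
  shows "selfadjoint_on S (sym_op bs a)"
  unfolding selfadjoint_on_def
proof (intro conjI ballI)
  show "linear (sym_op bs a)"
    by (auto intro!: linearI simp: sym_op_def inner_add_right algebra_simps sum.distrib
        scaleR_sum_right)
  show "sym_op bs a ` S \<subseteq> S"
    using orthonormal_basis_imp_subspace[OF bs] orthonormal_basis_props(3)[OF bs]
    by (auto simp: sym_op_def intro!: subspace_sum subspace_scale subspace_add)
  show "inner (sym_op bs a x) y = inner x (sym_op bs a y)" for x y
    unfolding inner_commute[of x] sym_op_form by (intro sum.cong) (auto simp: algebra_simps)
qed

lemma sym_op_trace:
  assumes bs: "orthonormal_basis S bs"
  shows "(\<Sum>k<length bs. inner (bs ! k) (sym_op bs a (bs ! k))) = (\<Sum>k<length bs. a k k)"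
proof (rule sum.cong)
  fix m assume "m \<in> {..<length bs}"
  then have m: "m < length bs" by simp
  have "inner (sym_op bs a (bs ! m)) (bs ! m) =
      (\<Sum>k<length bs. \<Sum>l<length bs. if k = m then if l = m then a k l else 0 else 0)"
    unfolding sym_op_quadratic_form using m
    by (intro sum.cong) (auto simp: orthonormal_basis_inner[OF bs])
  also have "\<dots> = (\<Sum>k<length bs. if k = m then \<Sum>l<length bs. if l = m then a k l else 0 else 0)"
    by (intro sum.cong) auto
  also have "\<dots> = a m m" using m by simp
  finally show "inner (bs ! m) (sym_op bs a (bs ! m)) = a m m" by (simp add: inner_commute)
qed simp

lemma inner_eq_from_matrix:
  assumes bs: "orthonormal_basis S bs" and f: "linear f"
    and id: "\<And>k l. k < length bs \<Longrightarrow> l < length bs \<Longrightarrow>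
      inner (bs ! k) (f (bs ! l)) = (if k = l then 1 else 0)"
    and x: "x \<in> S" and y: "y \<in> S"
  shows "inner x (f y) = inner x y"
proof -
  have "inner (bs ! k) (f y) = inner (bs ! k) y" if k: "k < length bs" for k
    by (subst orthonormal_basis_props(4)[OF bs y])
      (simp add: linear_sum[OF f] linear_scale[OF f] inner_sum_right id k if_distrib cong: if_cong)
  then show ?thesis by (simp add: orthonormal_basis_Parseval[OF bs x])
qed

section \<open>First-order optimality\<close>

lemma selfadjoint_family_diagonalizable:
  assumes "\<And>i. subspace (S i)" "\<And>i. selfadjoint_on (S i) (f i)"
  obtains bs l where "\<And>i. orthonormal_basis (S i) (bs i)"
    "\<And>i k. k < length (bs i) \<Longrightarrow> f i (bs i ! k) = l i k *\<^sub>R bs i ! k"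
proof -
  have "\<exists>b l. orthonormal_basis (S i) b \<and> (\<forall>k<length b. f i (b ! k) = l k *\<^sub>R b ! k)" for i
    by (rule selfadjoint_diagonalizable[OF assms(1)[of i] assms(2)[of i]]) blast
  then obtain bs l where "\<forall>i. orthonormal_basis (S i) (bs i) \<and>
      (\<forall>k<length (bs i). f i (bs i ! k) = l i k *\<^sub>R bs i ! k)"
    by metis
  then show thesis using that[of bs l] by blast
qed

lemma perturbed_id:
  fixes G :: "'a::euclidean_space \<Rightarrow> 'a"
  assumes S: "subspace S" and G: "selfadjoint_on S G" and bs: "orthonormal_basis S bs"
    and diag: "\<And>k. k < length bs \<Longrightarrow> G (bs ! k) = l k *\<^sub>R bs ! k"
    and pos: "\<And>k. k < length bs \<Longrightarrow> 0 < 1 + t * l k"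
  shows "posdef_on S (\<lambda>x. x + t *\<^sub>R G x)"
    and "ln (det_on S (\<lambda>x. x + t *\<^sub>R G x)) = (\<Sum>k<length bs. ln (1 + t * l k))"
proof -
  note lG = selfadjoint_onD(1)[OF G]
  have lin: "linear (\<lambda>x. x + t *\<^sub>R G x)"
    by (auto intro!: linearI simp: linear_add[OF lG] linear_scale[OF lG] algebra_simps)
  have diag': "bs ! k + t *\<^sub>R G (bs ! k) = (1 + t * l k) *\<^sub>R bs ! k" if "k < length bs" for k
    using diag[OF that] by (simp add: algebra_simps)
  have "selfadjoint_on S (\<lambda>x. x + t *\<^sub>R G x)"
    unfolding selfadjoint_on_def
  proof (intro conjI ballI lin)
    show "(\<lambda>x. x + t *\<^sub>R G x) ` S \<subseteq> S"
      using S selfadjoint_onD(2)[OF G] by (auto simp: subspace_add subspace_scale)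
    show "inner (x + t *\<^sub>R G x) y = inner x (y + t *\<^sub>R G y)" if "x \<in> S" "y \<in> S" for x y
      using selfadjoint_onD(3)[OF G that] by (simp add: inner_add_left inner_add_right)
  qed
  then show "posdef_on S (\<lambda>x. x + t *\<^sub>R G x)" using posdef_diagonalI[OF _ bs diag' pos] by blast
  have "det_on S (\<lambda>x. x + t *\<^sub>R G x) = (\<Prod>k<length bs. 1 + t * l k)"
    by (rule det_on_diagonal[OF bs lin diag'])
  then show "ln (det_on S (\<lambda>x. x + t *\<^sub>R G x)) = (\<Sum>k<length bs. ln (1 + t * l k))"
    by (simp only:) (rule ln_prod, use pos in \<open>auto simp: less_le\<close>)
qed

lemma eventually_perturbation_pos:
  fixes l :: "'i::finite \<Rightarrow> nat \<Rightarrow> real"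
  shows "\<forall>\<^sub>F t in at_right 0. \<forall>i. \<forall>k<n i. 0 < 1 + t * l i k"
proof -
  have "\<forall>\<^sub>F t in at_right 0. 0 < 1 + t * a" for a :: real
  proof -
    have "((\<lambda>t. 1 + t * a) \<longlongrightarrow> 1 + 0 * a) (at_right 0)" by (intro tendsto_intros)
    then show ?thesis by (rule order_tendstoD(1)) simp
  qed
  then have "\<forall>\<^sub>F t in at_right 0. \<forall>k\<in>{..<n i}. 0 < 1 + t * l i k" for i
    by (intro eventually_ball_finite) auto
  then have "\<forall>\<^sub>F t in at_right 0. \<forall>i\<in>UNIV. \<forall>k\<in>{..<n i}. 0 < 1 + t * l i k"
    by (intro eventually_ball_finite) auto
  then show ?thesis by (rule eventually_mono) auto
qed

lemma sum_Sigma_square: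
  fixes n :: "'k::finite \<Rightarrow> nat"
  shows "(\<Sum>q\<in>(SIGMA i:UNIV. {..<n i} \<times> {..<n i}). g q) = (\<Sum>i\<in>UNIV. \<Sum>k<n i. \<Sum>l<n i. g (i, k, l))"
  by (simp add: sum.Sigma sum.cartesian_product split_def)

lemma orthonormal_basis_family:
  assumes "\<And>i. subspace (S i)"
  obtains bs where "\<And>i. orthonormal_basis (S i) (bs i)"
  using orthonormal_basis_exists[OF assms] by metis

section \<open>Perturbations of an optimal identity pair\<close>

context datum
begin

lemma inner_E0: assumes "x \<in> E0" shows "inner x x = (\<Sum>i\<in>UNIV. inner (P i x) (P i x))"
proof -
  have "inner x x = inner (\<Sum>i\<in>UNIV. P i x) x" by (simp add: E0_sum[OF assms])
  then show ?thesis unfolding inner_sum_left by (simp add: inner_P[of _ x x])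
qed

lemma basis_P:
  assumes "orthonormal_basis (E i) bs" "k < length bs"
  shows "inner (bs ! k) (P i x) = inner (bs ! k) x"
  by (rule orth_proj_inner2[OF subE orthonormal_basis_props(3)[OF assms]])

text \<open>Adding \<open>t\<close> times the inequality for (\<open>H\<close>, \<open>G\<close>) to
  the one for the identity keeps it true for t > 0, and positive definiteness persists for small
  \<open>t\<close>. A positive derivative of the objective at 0 would then produce a feasible pair
  of positive value. The derivative is a difference of traces, computed in eigenbases and
  transferred to the given bases.\<close>

lemma first_order_optimality:
  assumes id: "gauss_feasible E F c d B (\<lambda>i x. x) (\<lambda>j y. y)"
    and opt: "\<And>V U. gauss_feasible E F c d B V U \<Longrightarrow> gauss_value E F c d V U \<le> 0"
    and H: "\<And>i. selfadjoint_on (E i) (H i)" and G: "\<And>j. selfadjoint_on (F j) (G j)"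
    and le: "\<And>x. (\<Sum>j\<in>UNIV. d j * inner (G j (Q j x)) (Q j x)) \<le> (\<Sum>i\<in>UNIV. c i * inner (H i (P i x)) (P i x))"
    and eb: "\<And>i. orthonormal_basis (E i) (eb i)" and fb: "\<And>j. orthonormal_basis (F j) (fb j)"
  shows "(\<Sum>j\<in>UNIV. d j * (\<Sum>k<length (fb j). inner (fb j ! k) (G j (fb j ! k))))
    \<le> (\<Sum>i\<in>UNIV. c i * (\<Sum>k<length (eb i). inner (eb i ! k) (H i (eb i ! k))))"
proof -
  obtain hb h where hb: "\<And>i. orthonormal_basis (E i) (hb i)"
    and h: "\<And>i k. k < length (hb i) \<Longrightarrow> H i (hb i ! k) = h i k *\<^sub>R hb i ! k"
    using selfadjoint_family_diagonalizable[of E H, OF subE H] by blast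
  obtain gb g where gb: "\<And>j. orthonormal_basis (F j) (gb j)"
    and g: "\<And>j k. k < length (gb j) \<Longrightarrow> G j (gb j ! k) = g j k *\<^sub>R gb j ! k"
    using selfadjoint_family_diagonalizable[of F G, OF subF G] by blast
  have trH: "(\<Sum>k<length (eb i). inner (eb i ! k) (H i (eb i ! k))) = (\<Sum>k<length (hb i). h i k)" for i
    using trace_basis_independent[OF eb hb selfadjoint_onD(1)[OF H], of i]
    by (simp add: h orthonormal_basis_inner[OF hb])
  have trG: "(\<Sum>k<length (fb j). inner (fb j ! k) (G j (fb j ! k))) = (\<Sum>k<length (gb j). g j k)" for j
    using trace_basis_independent[OF fb gb selfadjoint_onD(1)[OF G], of j]
    by (simp add: g orthonormal_basis_inner[OF gb])
  \<comment> \<open>Twice the objective along the perturbation, in terms of the eigenvalues of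
    \<open>G\<close> and \<open>H\<close>.\<close>
  define f where "f t = (\<Sum>j\<in>UNIV. d j * (\<Sum>k<length (gb j). ln (1 + t * g j k)))
      - (\<Sum>i\<in>UNIV. c i * (\<Sum>k<length (hb i). ln (1 + t * h i k)))" for t
  define f' where "f' = (\<Sum>j\<in>UNIV. d j * (\<Sum>k<length (gb j). g j k))
      - (\<Sum>i\<in>UNIV. c i * (\<Sum>k<length (hb i). h i k))"
  have le0: "f t \<le> 0" if t: "0 < t" "\<forall>j. \<forall>k<length (gb j). 0 < 1 + t * g j k"
    "\<forall>i. \<forall>k<length (hb i). 0 < 1 + t * h i k" for t
  proof -
    note V = perturbed_id[where t = t, OF subE H hb h] and U = perturbed_id[where t = t, OF subF G gb g]
    have "(\<Sum>j\<in>UNIV. d j * inner (Q j x + t *\<^sub>R G j (Q j x)) (Q j x))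
        \<le> (\<Sum>i\<in>UNIV. c i * inner (P i x + t *\<^sub>R H i (P i x)) (P i x))" for x
    proof -
      have "(\<Sum>j\<in>UNIV. d j * inner (Q j x) (Q j x)) \<le> (\<Sum>i\<in>UNIV. c i * inner (P i x) (P i x))"
        using id unfolding gauss_feasible_iff by blast
      moreover note mult_left_mono[OF le[of x] less_imp_le[OF t(1)]]
      ultimately have "(\<Sum>j\<in>UNIV. d j * inner (Q j x) (Q j x)) + t * (\<Sum>j\<in>UNIV. d j * inner (G j (Q j x)) (Q j x))
          \<le> (\<Sum>i\<in>UNIV. c i * inner (P i x) (P i x)) + t * (\<Sum>i\<in>UNIV. c i * inner (H i (P i x)) (P i x))"
        by (rule add_mono)
      then show ?thesis
        by (simp add: inner_add_left distrib_left sum.distrib sum_distrib_left mult.left_commute)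
    qed
    then have "gauss_feasible E F c d B (\<lambda>i x. x + t *\<^sub>R H i x) (\<lambda>j y. y + t *\<^sub>R G j y)"
      unfolding gauss_feasible_iff using V(1) U(1) t by blast
    from opt[OF this] show ?thesis using V(2) U(2) t by (simp add: gauss_value_def f_def)
  qed
  have "(f has_real_derivative f') (at 0)"
    unfolding f_def f'_def
    by (auto intro!: derivative_eq_intros DERIV_sum simp: sum_distrib_left mult.commute)
  then have "\<not> 0 < f'"
  proof (intro notI)
    assume D: "(f has_real_derivative f') (at 0)" "0 < f'"
    obtain e where e: "0 < e" "\<And>t. 0 < t \<Longrightarrow> t < e \<Longrightarrow> f 0 < f (0 + t)"
      using DERIV_pos_inc_right[OF D] by blast
    have "\<forall>\<^sub>F t in at_right 0. t \<in> {0<..<e}"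
      using e(1) by (rule eventually_at_right_real)
    with eventually_perturbation_pos[of "\<lambda>j. length (gb j)" g]
      eventually_perturbation_pos[of "\<lambda>i. length (hb i)" h]
    have "\<forall>\<^sub>F t in at_right 0. f 0 < f t \<and> f t \<le> 0"
      by eventually_elim (use e(2) le0 in auto)
    then obtain t where "f 0 < f t" "f t \<le> 0"
      using eventually_happens'[OF trivial_limit_at_right_real] by blast
    then show False by (simp add: f_def)
  qed
  then show ?thesis by (simp add: trH trG f'_def)
qed

lemma coupling_solution:
  fixes T :: "'a \<Rightarrow>\<^sub>L 'a"
  assumes T: "T \<in> trace_psd_set E0 I e n"
    and eb: "\<And>i. orthonormal_basis (E i) (eb i)" and fb: "\<And>j. orthonormal_basis (F j) (fb j)"
    and TE: "\<And>i k l. k < length (eb i) \<Longrightarrow> l < length (eb i) \<Longrightarrow>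
      inner (eb i ! k) (T (eb i ! l)) = (if k = l then 1 else 0)"
    and TF: "\<And>j k l. k < length (fb j) \<Longrightarrow> l < length (fb j) \<Longrightarrow>
      inner (adjoint (Q j) (fb j ! k)) (T (adjoint (Q j) (fb j ! l))) = (if k = l then 1 else 0)"
  shows "blinfun_apply T \<in> id_couplings E" and "y \<in> F j \<Longrightarrow> Q j (T (adjoint (Q j) y)) = y"
proof -
  note sa = trace_psd_set_selfadjoint[OF subE0 T]
  note lT = selfadjoint_onD(1)[OF sa]
  have "inner (T x) x = inner x x" if "x \<in> E i" for i x
    using inner_eq_from_matrix[OF eb lT TE that that] by (simp add: inner_commute)
  then show "blinfun_apply T \<in> id_couplings E"
    using sa trace_psd_setD(2)[OF T] by (auto simp: id_couplings_def possemidef_on_def)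
  assume y: "y \<in> F j"
  let ?f = "\<lambda>y. Q j (T (adjoint (Q j) y))"
  have lin: "linear ?f"
    using linear_compose[OF linear_compose[OF lin_adjQ lT] linQ] by (simp add: o_def)
  have "inner x (?f y) = inner x y" if "x \<in> F j" for x
    by (rule inner_eq_from_matrix[OF fb lin _ that y]) (simp add: TF flip: adjQ(2))
  then have "inner (?f y - y) (?f y - y) = 0"
    using y by (simp add: inner_diff_right subspace_diff Q_in)
  then show "?f y = y" by simp
qed

text \<open>Writing \<open>A i\<close> and \<open>B j\<close> for the symmetrised coefficient
  operators, the direction is H = (A - \<open>\<kappa>\<close>) / c and G = - B / d. The hypothesis
  \<open>ge\<close> says that this direction is admissible, and the conclusion is the resulting
  inequality of traces; division by \<open>c\<close> and \<open>d\<close> cancels the weights on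
  both sides.\<close>

lemma sum_coefficients_le:
  fixes a :: "'k \<Rightarrow> nat \<Rightarrow> nat \<Rightarrow> real" and b :: "'m \<Rightarrow> nat \<Rightarrow> nat \<Rightarrow> real"
  assumes id: "gauss_feasible E F c d B (\<lambda>i x. x) (\<lambda>j y. y)"
    and opt: "\<And>V U. gauss_feasible E F c d B V U \<Longrightarrow> gauss_value E F c d V U \<le> 0"
    and eb: "\<And>i. orthonormal_basis (E i) (eb i)" and fb: "\<And>j. orthonormal_basis (F j) (fb j)"
    and ge: "\<And>x. x \<in> E0 \<Longrightarrow> \<kappa> * inner x x \<le>
      (\<Sum>i\<in>UNIV. \<Sum>k<length (eb i). \<Sum>l<length (eb i). a i k l * (inner (eb i ! k) x * inner (eb i ! l) x)) +
      (\<Sum>j\<in>UNIV. \<Sum>k<length (fb j). \<Sum>l<length (fb j). b j k l * (inner (fb j ! k) (Q j x) * inner (fb j ! l) (Q j x)))"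
  shows "\<kappa> * (\<Sum>i\<in>UNIV. real (length (eb i))) \<le>
    (\<Sum>i\<in>UNIV. \<Sum>k<length (eb i). a i k k) + (\<Sum>j\<in>UNIV. \<Sum>k<length (fb j). b j k k)"
proof -
  define H where "H i x = (1 / c i) *\<^sub>R (sym_op (eb i) (a i) x - \<kappa> *\<^sub>R x)" for i x
  define G where "G j y = (- 1 / d j) *\<^sub>R sym_op (fb j) (b j) y" for j y
  have c: "c i \<noteq> 0" and d: "d j \<noteq> 0" for i j using cpos[of i] dpos[of j] by auto
  note saE = sym_op_selfadjoint[OF eb] and saF = sym_op_selfadjoint[OF fb]
  note linE = selfadjoint_onD(1)[OF saE] and linF = selfadjoint_onD(1)[OF saF]
  have H: "selfadjoint_on (E i) (H i)" for i
    unfolding selfadjoint_on_def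
  proof (intro conjI ballI)
    show "linear (H i)"
      by (auto intro!: linearI simp: H_def linear_add[OF linE] linear_scale[OF linE] algebra_simps)
    show "H i ` E i \<subseteq> E i"
      using selfadjoint_onD(2)[OF saE] by (auto simp: H_def subspace_diff subspace_scale)
    show "inner (H i x) y = inner x (H i y)" if "x \<in> E i" "y \<in> E i" for x y
      using selfadjoint_onD(3)[OF saE that] by (simp add: H_def inner_diff_left inner_diff_right)
  qed
  have G: "selfadjoint_on (F j) (G j)" for j
    unfolding selfadjoint_on_def
  proof (intro conjI ballI)
    show "linear (G j)"
      by (auto intro!: linearI simp: G_def linear_add[OF linF] linear_scale[OF linF] algebra_simps)
    show "G j ` F j \<subseteq> F j"
      using selfadjoint_onD(2)[OF saF] by (auto simp: G_def subspace_neg subspace_scale)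
    show "inner (G j x) y = inner x (G j y)" if "x \<in> F j" "y \<in> F j" for x y
      using selfadjoint_onD(3)[OF saF that] by (simp add: G_def)
  qed
  have "(\<Sum>j\<in>UNIV. d j * inner (G j (Q j x)) (Q j x)) \<le> (\<Sum>i\<in>UNIV. c i * inner (H i (P i x)) (P i x))" for x
  proof -
    define z where "z = orth_proj E0 x"
    have z: "z \<in> E0" and zQ: "Q j z = Q j x" and zP: "P i z = P i x" for i j
      by (auto simp: z_def orth_proj_in Q_orth_proj_E0 P_orth_proj_E0)
    have zz: "inner z z = (\<Sum>i\<in>UNIV. inner (P i x) (P i x))"
      by (simp add: inner_E0[OF z] zP)
    have eP: "inner (eb i ! k) (P i x) = inner (eb i ! k) z" if "k < length (eb i)" for i k
      using basis_P[OF eb that] by (simp flip: zP)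
    have "(\<Sum>i\<in>UNIV. c i * inner (H i (P i x)) (P i x)) =
        (\<Sum>i\<in>UNIV. \<Sum>k<length (eb i). \<Sum>l<length (eb i). a i k l * (inner (eb i ! k) z * inner (eb i ! l) z))
        - \<kappa> * inner z z"
      by (simp add: H_def inner_diff_left c sym_op_quadratic_form eP sum_subtractf zz sum_distrib_left)
    moreover have "(\<Sum>j\<in>UNIV. d j * inner (G j (Q j x)) (Q j x)) =
        - (\<Sum>j\<in>UNIV. \<Sum>k<length (fb j). \<Sum>l<length (fb j). b j k l * (inner (fb j ! k) (Q j z) * inner (fb j ! l) (Q j z)))"
      by (simp add: G_def d sym_op_quadratic_form zQ sum_negf)
    ultimately show ?thesis using ge[OF z] by simp
  qed
  from first_order_optimality[OF id opt H G this eb fb]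
  have "(\<Sum>j\<in>UNIV. d j * (\<Sum>k<length (fb j). inner (fb j ! k) (G j (fb j ! k))))
    \<le> (\<Sum>i\<in>UNIV. c i * (\<Sum>k<length (eb i). inner (eb i ! k) (H i (eb i ! k))))" .
  moreover have "d j * (\<Sum>k<length (fb j). inner (fb j ! k) (G j (fb j ! k))) = - (\<Sum>k<length (fb j). b j k k)" for j
    by (simp add: G_def d sum_negf sym_op_trace[OF fb] flip: sum_divide_distrib)
  moreover have "c i * (\<Sum>k<length (eb i). inner (eb i ! k) (H i (eb i ! k))) =
      (\<Sum>k<length (eb i). a i k k) - \<kappa> * real (length (eb i))" for i
    by (simp add: H_def c inner_diff_right orthonormal_basis_inner[OF eb] sum_subtractf sym_op_trace[OF eb]
        flip: sum_divide_distrib)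
  ultimately show ?thesis by (simp add: sum_negf sum_subtractf sum_distrib_left)
qed

text \<open>The case without rank-one operators to test on. Since all \<open>d j\<close> are
  positive, the dimension condition forces every \<open>F j\<close> to be zero as well.\<close>

lemma zero_coupling:
  assumes "E0 \<subseteq> {0}"
  shows "(\<lambda>x. 0) \<in> id_couplings E" and "y \<in> F j \<Longrightarrow> y = 0"
proof -
  have E: "E i \<subseteq> {0}" for i using assms E_E0 by blast
  then show "(\<lambda>x. 0) \<in> id_couplings E"
    by (auto simp: id_couplings_def possemidef_on_def selfadjoint_on_def linear_zero subspace_0)
  have "(\<Sum>j\<in>UNIV. d j * real (dim (F j))) = 0"
    using E dims by (simp add: dim_eq_0[THEN iffD2])
  then have "d j * real (dim (F j)) = 0"
    using dpos by (subst (asm) sum_nonneg_eq_0_iff) (auto simp: less_imp_le)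
  then have "dim (F j) = 0" using dpos[of j] by simp
  then show "y \<in> F j \<Longrightarrow> y = 0" by (auto simp: dim_eq_0)
qed

lemma optimal_id_imp_geometric:
  assumes id: "gauss_feasible E F c d B (\<lambda>i x. x) (\<lambda>j y. y)"
    and opt: "\<And>V U. gauss_feasible E F c d B V U \<Longrightarrow> gauss_value E F c d V U \<le> 0"
  shows "geometric E F c d B"
proof -
  have "\<exists>T\<in>id_couplings E. \<forall>j. \<forall>y\<in>F j. Q j (T (adjoint (Q j) y)) = y"
  proof (cases "E0 \<subseteq> {0}")
    case True
    show ?thesis
    proof (intro bexI[OF _ zero_coupling(1)[OF True]] allI ballI)
      show "Q j 0 = y" if "y \<in> F j" for j y
        using zero_coupling(2)[OF True that] linear_0[OF linQ] by simp
    qed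
  next
    case False
    then obtain x0 where x0: "x0 \<in> E0" "x0 \<noteq> 0" by blast
    obtain eb where eb: "\<And>i. orthonormal_basis (E i) (eb i)"
      using orthonormal_basis_family[of E, OF subE] by blast
    obtain fb where fb: "\<And>j. orthonormal_basis (F j) (fb j)"
      using orthonormal_basis_family[of F, OF subF] by blast
    define I where "I = (SIGMA i:UNIV. {..<length (eb i)})"
    define e where "e p = eb (fst p) ! snd p" for p
    \<comment> \<open>The trace of any coupling: each of the basis vectors \<open>e p\<close>
      contributes 1.\<close>
    define n where "n = (\<Sum>i\<in>UNIV. real (length (eb i)))"
    have eE0: "e p \<in> E0" if "p \<in> I" for p
      using that orthonormal_basis_props(3)[OF eb] by (intro E_E0[of _ "fst p"]) (auto simp: I_def e_def)
    have frame: "(\<Sum>p\<in>I. (inner (e p) x)\<^sup>2) = inner x x" if "x \<in> E0" for x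
      by (simp add: I_def e_def sum_Sigma_lessThan inner_E0[OF that]
          orthonormal_basis_Parseval[OF eb P_in] basis_P[OF eb] power2_eq_square)
    have "0 < n"
    proof (rule ccontr)
      assume "\<not> 0 < n"
      moreover have "0 \<le> n" unfolding n_def by (intro sum_nonneg) auto
      ultimately have "n = 0" by simp
      then have "\<forall>i\<in>UNIV. real (length (eb i)) = 0"
        unfolding n_def by (subst (asm) sum_nonneg_eq_0_iff) auto
      then have "I = {}" by (auto simp: I_def)
      then show False using frame[OF x0(1)] x0(2) by simp
    qed
    define K where "K = trace_psd_set E0 I e n"
    have "bounded K" unfolding K_def bounded_iff
      using trace_psd_set_bound[OF subE0 _ eE0 frame] by blast
    then have K: "compact K" "convex K"
      unfolding K_def by (auto simp: compact_eq_bounded_closed trace_psd_set_closed trace_psd_set_convex)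
    have rank_one: "\<exists>T\<in>K. \<forall>y. blinfun_apply T y = (n / inner x x * inner x y) *\<^sub>R x"
      if "x \<in> E0" "x \<noteq> 0" for x
      using trace_psd_set_rank_one[OF subE0 that less_imp_le[OF \<open>0 < n\<close>] frame]
      unfolding K_def by metis
    then have "K \<noteq> {}" using x0 by blast
    define LE where "LE = (SIGMA i:UNIV. {..<length (eb i)} \<times> {..<length (eb i)})"
    define LF where "LF = (SIGMA j:UNIV. {..<length (fb j)} \<times> {..<length (fb j)})"
    have fin: "finite LE" "finite LF" by (auto simp: LE_def LF_def)
    \<comment> \<open>The matrix entries of the diagonal blocks of \<open>T\<close> and of the
      operators Q T Q*. A coupling of the required kind is a point of \<open>K\<close> at which all
      these matrices are identities, which is the target \<open>t\<close>.\<close>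
    define \<phi> :: "('k \<times> nat \<times> nat) + ('m \<times> nat \<times> nat) \<Rightarrow> ('a \<Rightarrow>\<^sub>L 'a) \<Rightarrow> real" where
      "\<phi> q T = (case q of Inl (i, k, l) \<Rightarrow> inner (eb i ! k) (T (eb i ! l))
        | Inr (j, k, l) \<Rightarrow> inner (adjoint (Q j) (fb j ! k)) (T (adjoint (Q j) (fb j ! l))))" for q T
    define t :: "('k \<times> nat \<times> nat) + ('m \<times> nat \<times> nat) \<Rightarrow> real" where
      "t q = (case q of Inl (i, k, l) \<Rightarrow> if k = l then 1 else 0 | Inr (j, k, l) \<Rightarrow> if k = l then 1 else 0)" for q
    have lin: "linear (\<phi> q)" for q
      by (auto intro!: linearI simp: \<phi>_def blinfun.add_left blinfun.scaleR_left inner_add_right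
          split: sum.splits prod.splits)
    have cont: "continuous_on K (\<phi> q)" for q
      by (cases q) (auto simp: \<phi>_def[abs_def] split_def intro!: continuous_intros)
    have sum_L: "(\<Sum>q\<in>LE <+> LF. f q) =
        (\<Sum>i\<in>UNIV. \<Sum>k<length (eb i). \<Sum>l<length (eb i). f (Inl (i, k, l))) +
        (\<Sum>j\<in>UNIV. \<Sum>k<length (fb j). \<Sum>l<length (fb j). f (Inr (j, k, l)))" for f :: "_ \<Rightarrow> real"
      by (simp add: sum.Plus fin) (simp add: LE_def LF_def sum_Sigma_square)
    have "finite (LE <+> LF)" using fin by simp
    note fin_L = this
    consider (solution) T where "T \<in> K" "\<And>q. q \<in> LE <+> LF \<Longrightarrow> \<phi> q T = t q"
      | (separation) r \<rho> where "0 < \<rho>"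
        "\<And>T. T \<in> K \<Longrightarrow> (\<Sum>q\<in>LE <+> LF. r q * t q) + \<rho> \<le> (\<Sum>q\<in>LE <+> LF. r q * \<phi> q T)"
      by (rule residual_separation[where \<phi> = \<phi> and t = t, OF K \<open>K \<noteq> {}\<close> lin cont fin_L]) blast+
    then show ?thesis
    proof cases
      case solution
      have T: "T \<in> trace_psd_set E0 I e n" using solution(1) by (simp add: K_def)
      have TE: "inner (eb i ! k) (T (eb i ! l)) = (if k = l then 1 else 0)"
        if "k < length (eb i)" "l < length (eb i)" for i k l
        using solution(2)[OF InlI, of "(i, k, l)"] that by (simp add: \<phi>_def t_def LE_def)
      have TF: "inner (adjoint (Q j) (fb j ! k)) (T (adjoint (Q j) (fb j ! l))) = (if k = l then 1 else 0)"
        if "k < length (fb j)" "l < length (fb j)" for j k l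
        using solution(2)[OF InrI, of "(j, k, l)"] that by (simp add: \<phi>_def t_def LF_def)
      show ?thesis using coupling_solution[OF T eb fb TE TF] by blast
    next
      case separation
      define \<tau> where "\<tau> = (\<Sum>q\<in>LE <+> LF. r q * t q)"
      \<comment> \<open>The separation at the rank-one operator along \<open>x\<close>, multiplied
        by \<open>inner x x / n\<close> to undo the normalisation of its trace.\<close>
      have "(\<tau> + \<rho>) / n * inner x x \<le>
        (\<Sum>i\<in>UNIV. \<Sum>k<length (eb i). \<Sum>l<length (eb i).
          r (Inl (i, k, l)) * (inner (eb i ! k) x * inner (eb i ! l) x)) +
        (\<Sum>j\<in>UNIV. \<Sum>k<length (fb j). \<Sum>l<length (fb j).
          r (Inr (j, k, l)) * (inner (fb j ! k) (Q j x) * inner (fb j ! l) (Q j x)))"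
        (is "_ \<le> ?R x") if x: "x \<in> E0" for x
      proof (cases "x = 0")
        case True
        then show ?thesis using linear_0[OF linQ] by simp
      next
        case False
        obtain T where T: "T \<in> K" "\<And>y. blinfun_apply T y = (n / inner x x * inner x y) *\<^sub>R x"
          using rank_one[OF x False] by blast
        have T2: "blinfun_apply T y = (n / inner x x * inner y x) *\<^sub>R x" for y
          unfolding T(2) by (simp add: inner_commute)
        have "\<tau> + \<rho> \<le> (\<Sum>q\<in>LE <+> LF. r q * \<phi> q T)" using separation(2)[OF T(1)] by (simp add: \<tau>_def)
        also have "\<dots> = n / inner x x * ?R x"
          unfolding sum_L distrib_left sum_distrib_left
          by (intro arg_cong2[where f = "(+)"] sum.cong refl)
            (simp_all add: \<phi>_def T2 adjQ)
        finally show ?thesis using False \<open>0 < n\<close> by (simp add: field_simps)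
      qed
      \<comment> \<open>Pairing \<open>r\<close> with the identity matrices in \<open>t\<close>
        picks out the diagonal coefficients, so the trace inequality says
        \<open>\<tau> + \<rho> \<le> \<tau>\<close>.\<close>
      from sum_coefficients_le[OF id opt eb fb this]
      have "(\<tau> + \<rho>) / n * n \<le> (\<Sum>i\<in>UNIV. \<Sum>k<length (eb i). r (Inl (i, k, k))) +
          (\<Sum>j\<in>UNIV. \<Sum>k<length (fb j). r (Inr (j, k, k)))"
        unfolding n_def .
      also have "\<dots> = \<tau>"
        unfolding \<tau>_def sum_L by (simp add: t_def if_distrib cong: if_cong)
      finally show ?thesis using separation(1) \<open>0 < n\<close> by simp
    qed
  qed
  then show ?thesis
    using id dims unfolding geometric_def gauss_feasible_id_iff by blast
qed

lemma extremizable_imp_equivalent_geometric: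
  assumes "gaussian_extremizable E F c d B"
  shows "\<exists>B'. is_datum E F c d B' \<and> geometric E F c d B' \<and> equivalent_data E F c d B c d B'"
proof -
  let ?S = "Sup (gauss_values E F c d B)"
  have bdd: "bdd_above (gauss_values E F c d B)" and "?S \<in> gauss_values E F c d B"
    using assms by (auto simp: gaussian_extremizable_def)
  then obtain V U where S: "?S = gauss_value E F c d V U" and feas: "gauss_feasible E F c d B V U"
    unfolding gauss_values_eq by blast
  have V: "posdef_on (E i) (V i)" and U: "posdef_on (F j) (U j)" for i j
    using feas unfolding gauss_feasible_iff by blast+
  have sqrtE: "\<exists>M N. linear M \<and> linear N \<and> (\<forall>x. M x \<in> E i) \<and> (\<forall>x. N x \<in> E i) \<and>
      (\<forall>x\<in>E i. M (N x) = x) \<and> (\<forall>x\<in>E i. N (M x) = x) \<and>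
      (\<forall>x\<in>E i. \<forall>y\<in>E i. inner (V i (M x)) (M y) = inner x y)" for i
    by (rule posdef_inverse_sqrt[OF subE V[of i]]) blast
  have sqrtF: "\<exists>M N. linear M \<and> linear N \<and> (\<forall>x. M x \<in> F j) \<and> (\<forall>x. N x \<in> F j) \<and>
      (\<forall>x\<in>F j. M (N x) = x) \<and> (\<forall>x\<in>F j. N (M x) = x) \<and>
      (\<forall>x\<in>F j. \<forall>y\<in>F j. inner (U j (M x)) (M y) = inner x y)" for j
    by (rule posdef_inverse_sqrt[OF subF U[of j]]) blast
  obtain R R' where R: "\<And>i. linear (R i)" "\<And>i. linear (R' i)" "\<And>i x. R i x \<in> E i" "\<And>i x. R' i x \<in> E i"
    "\<And>i x. x \<in> E i \<Longrightarrow> R i (R' i x) = x" "\<And>i x. x \<in> E i \<Longrightarrow> R' i (R i x) = x"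
    "\<And>i x y. x \<in> E i \<Longrightarrow> y \<in> E i \<Longrightarrow> inner (V i (R i x)) (R i y) = inner x y"
    using sqrtE by metis
  obtain M M' where M: "\<And>j. linear (M j)" "\<And>j. linear (M' j)" "\<And>j x. M j x \<in> F j" "\<And>j x. M' j x \<in> F j"
    "\<And>j x. x \<in> F j \<Longrightarrow> M j (M' j x) = x" "\<And>j x. x \<in> F j \<Longrightarrow> M' j (M j x) = x"
    "\<And>j x y. x \<in> F j \<Longrightarrow> y \<in> F j \<Longrightarrow> inner (U j (M j x)) (M j y) = inner x y"
    using sqrtF by metis
  \<comment> \<open>\<open>R i\<close> and \<open>M j\<close> act as inverse square roots of the
    optimal \<open>V i\<close> and \<open>U j\<close>, while \<open>R'\<close> and \<open>M'\<close>
    undo them. Thus B' is U^(1/2) B V^(-1/2), and the pullback of the optimal pair is the identity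
    pair.\<close>
  define C where "C x = (\<Sum>i\<in>UNIV. R i (P i x))" for x
  define C' where "C' x = (\<Sum>i\<in>UNIV. R' i (P i x))" for x
  define B' where "B' i j x = M' j (B i j (R i x))" for i j x
  have PC: "P i (C x) = R i (P i x)" "P i (C' x) = R' i (P i x)" for i x
    unfolding C_def C'_def by (rule P_sum, rule R)+
  have C_E: "C x = R i x" and C'_E: "C' x = R' i x" if "x \<in> E i" for i x
  proof -
    have "(\<Sum>i'\<in>UNIV. if i' = i then R i' x else 0) = R i x"
      "(\<Sum>i'\<in>UNIV. if i' = i then R' i' x else 0) = R' i x" by simp_all
    moreover have "R i' (P i' x) = (if i' = i then R i' x else 0)"
      "R' i' (P i' x) = (if i' = i then R' i' x else 0)" for i'
      using P_E[OF that, of i'] linear_0[OF R(1)] linear_0[OF R(2)] by auto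
    ultimately show "C x = R i x" "C' x = R' i x" unfolding C_def C'_def by simp_all
  qed
  have linC: "linear C" "linear C'"
    by (auto intro!: linearI simp: C_def C'_def linear_add[OF linP] linear_add[OF R(1)]
        linear_add[OF R(2)] linear_scale[OF linP] linear_scale[OF R(1)] linear_scale[OF R(2)]
        sum.distrib scaleR_sum_right)
  have C_in: "C x \<in> E0" "C' x \<in> E0" for x
    unfolding C_def C'_def using E_E0[OF R(3)] E_E0[OF R(4)] by (auto intro!: subspace_sum)
  have CC': "C (C' x) = x" "C' (C x) = x" if "x \<in> E0" for x
  proof -
    have "C (C' x) = (\<Sum>i\<in>UNIV. P i x)" unfolding C_def[of "C' x"] by (simp add: PC R(5))
    then show "C (C' x) = x" by (simp add: E0_sum[OF that])
    have "C' (C x) = (\<Sum>i\<in>UNIV. P i x)" unfolding C'_def[of "C x"] by (simp add: PC R(6))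
    then show "C' (C x) = x" by (simp add: E0_sum[OF that])
  qed
  have datum': "is_datum E F c d B'"
  proof -
    have "linear (B' i j)" for i j
      using linear_compose[OF linear_compose[OF R(1) linB] M(2)] by (simp add: B'_def[abs_def] o_def)
    then show ?thesis using datum M(4) by (auto simp: is_datum_def B'_def)
  qed
  have total': "total_map E B' j x = M' j (total_map E B j (C x))" for j x
    by (simp add: total_map_def PC B'_def linear_sum[OF M(2)])
  have inj: "inj_on C E0" "inj_on C' E0" "inj_on (M j) (F j)" "inj_on (M' j) (F j)" for j
    using CC' M(5,6) inj_on_inverseI[of "F j" "M' j" "M j"] inj_on_inverseI[of "F j" "M j" "M' j"]
      inj_on_inverseI[of E0 C' C] inj_on_inverseI[of E0 C C'] by blast+
  interpret iso: datum_isomorphism E F c d B B' C M C' M'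
  proof (intro datum_isomorphism.intro datum_morphism.intro
      datum_isomorphism_axioms.intro datum_morphism_axioms.intro datum.intro datum datum')
    show "M j (total_map E B' j x) = total_map E B j (C x)" for j x
      by (simp add: total' M(5) total_in)
    show "M' j (total_map E B j x) = total_map E B' j (C' x)" if "x \<in> E0" for j x
      by (simp add: total' CC' that)
  qed (use inj M R linC CC' C_E C'_E in auto)
  have pull: "iso.pull_V V i x = x" if x: "x \<in> E i" for i x
  proof -
    have "inner (iso.pull_V V i x - x) y = 0" if y: "y \<in> E i" for y
      unfolding inner_diff_left iso.pull_V_props(1)[OF V y] using x y R(7) by (simp add: C_E)
    from this[of "iso.pull_V V i x - x"] show ?thesis using x by (simp add: subspace_diff)
  qed
  have pull': "iso.pull_U U j y = y" if y: "y \<in> F j" for j y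
  proof -
    have "inner (iso.pull_U U j y - y) x = 0" if x: "x \<in> F j" for x
      using x y M(7) by (simp add: inner_diff_left iso.pull_U_props(1)[OF U])
    from this[of "iso.pull_U U j y - y"] show ?thesis using y by (simp add: subspace_diff orth_proj_in)
  qed
  have "gauss_feasible E F c d B' (\<lambda>i x. x) (\<lambda>j y. y)"
    using iso.pull_feasible(1)[OF feas]
    by (simp add: iso.B'.gauss_feasible_iff pull pull' iso.B'.Q_in posdef_on_id)
  moreover have "gauss_value E F c d V2 U2 \<le> 0" if "gauss_feasible E F c d B' V2 U2" for V2 U2
  proof -
    have "gauss_value E F c d (iso.pull_V V) (iso.pull_U U) = 0"
      using det_on_cong[OF subE pull] det_on_cong[OF subF pull'] by (simp add: gauss_value_def det_on_id)
    \<comment> \<open>The pulled-back optimal pair has value 0, so the shift is minus the supremum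
      for \<open>B\<close>; translated back, no value for \<open>B'\<close> can exceed 0.\<close>
    then have 0: "?S + value_shift E F c d C M = 0" using iso.pull_feasible(2)[OF feas] S by simp
    have "gauss_value E F c d V2 U2 \<in> gauss_values E F c d B'" using that unfolding gauss_values_eq by blast
    from cSup_upper[OF iso.inv.gauss_values_shift[OF this] bdd]
    show ?thesis using 0 iso.value_shift_inverse by simp
  qed
  ultimately have "geometric E F c d B'" by (rule iso.B'.optimal_id_imp_geometric)
  moreover have "equivalent_data E F c d B c d B'"
    unfolding equivalent_data_def
  \<comment> \<open>Equivalence composes \<open>B\<close> with the inverses of its witnesses. As
    \<open>B'\<close> is \<open>B\<close> composed with \<open>C\<close> and \<open>M'\<close>, the
    witnesses are \<open>C'\<close> and \<open>M\<close>.\<close>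
  proof (intro conjI refl exI[of _ C'] exI[of _ M] allI ballI)
    have bC: "bij_betw C' E0 E0" by (rule bij_betw_byWitness[of _ C]) (use CC' C_in in auto)
    have bM: "bij_betw (M j) (F j) (F j)" for j
      by (rule bij_betw_byWitness[of _ "M' j"]) (use M in auto)
    show "invertible_on E0 C'" "invertible_on (F j) (M j)" for j
      using bC bM linC M(1) by (auto simp: invertible_on_def)
    show "C' ` E i \<subseteq> E i" for i using C'_E R(4) by auto
    fix j x assume x: "x \<in> E0"
    have "inv_into E0 C' x = C x"
      by (rule inv_into_f_eq[OF inj(2)]) (use C_in CC' x in auto)
    moreover have "inv_into (F j) (M j) y = M' j y" if "y \<in> F j" for y
      by (rule inv_into_f_eq[OF inj(3)]) (use M that in auto)
    ultimately show "total_map E B' j x = inv_into (F j) (M j) (total_map E B j (inv_into E0 C' x))"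
      by (simp add: total' total_in)
  qed
  ultimately show ?thesis using datum' by blast
qed

end

theorem theorem1p23:
  fixes E :: "'k::finite \<Rightarrow> 'a::euclidean_space set"
    and F :: "'m::finite \<Rightarrow> 'b::euclidean_space set"
    and c :: "'k \<Rightarrow> real" and d :: "'m \<Rightarrow> real"
    and B :: "'k \<Rightarrow> 'm \<Rightarrow> 'a \<Rightarrow> 'b"
  assumes "is_datum E F c d B"
  shows "gaussian_extremizable E F c d B \<longleftrightarrow>
    (\<exists>B'. is_datum E F c d B' \<and> geometric E F c d B' \<and> equivalent_data E F c d B c d B')"
proof
  interpret datum E F c d B by (rule datum.intro[OF assms])
  show "gaussian_extremizable E F c d B \<Longrightarrow>
    \<exists>B'. is_datum E F c d B' \<and> geometric E F c d B' \<and> equivalent_data E F c d B c d B'"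
    by (rule extremizable_imp_equivalent_geometric)
  assume "\<exists>B'. is_datum E F c d B' \<and> geometric E F c d B' \<and> equivalent_data E F c d B c d B'"
  then obtain B' where B': "is_datum E F c d B'" "geometric E F c d B'" "equivalent_data E F c d B c d B'"
    by blast
  obtain C M C' M' where "datum_isomorphism E F c d B B' C M C' M'"
    using equivalent_data_isomorphism[OF B'(1,3)] .
  then show "gaussian_extremizable E F c d B"
    using datum_isomorphism.extremizable_imp datum.geometric_imp_extremizable[OF datum.intro[OF B'(1)] B'(2)]
    by blast
qed

end
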